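(* Let $(\mathbf{u}^n,p^n,\phi^n,\mu_\phi^n,c_1^n,\mu_1^n,c_2^n,\mu_2^n,c_3^n,\mu_3^n)$, $n\ge0$, be (sufficiently regular) solutions, with $c_i^n+1>0$ for $i=1,2,3$, of the first-order time-discrete scheme written out in the context, with time step $\Delta t>0$. Then mass is conserved in the sense that, for all $n$, $$\int_\Omega(c_1^n+c_2^n+c_3^n)\,d\mathbf{x}=\int_\Omega(c_1^0+c_2^0+c_3^0)\,d\mathbf{x}.$$ Moreover, if $S\ge\frac L2$, the scheme is energy stable: for every $n\ge0$ there is a quantity $\mathcal{T}^{n+1,n}\ge0$ such that $$\begin{aligned}\mathcal{E}^{n+1}-\mathcal{E}^n+\mathcal{T}^{n+1,n}=-\Delta t\Big(&\mathcal{M}\|\nabla\mu_\phi^{n+1}\|_{L^2}^2+\int_\Omega\Big[\frac{D_1^n(c_1^{n+1}+1)}{Pe}|\nabla\mu_1^{n+1}|^2+\frac{D_2(c_2^{n+1}+1)}{Pe}|\nabla\mu_2^{n+1}|^2\\&+\frac{D_3(c_3^{n+1}+1)}{Pe}|\nabla\mu_3^{n+1}|^2\Big]d\mathbf{x}+\big\|\sqrt{P(\phi^n)}(a_1\mu_1^{n+1}+a_2\mu_2^{n+1}-a_3\mu_3^{n+1})\big\|_{L^2}^2\Big)\le0,\end{aligned}$$ where the discrete energy is $$\begin{aligned}\mathcal{E}^n=&\frac{Re}2\|\mathbf{u}^n\|_{L^2}^2+\int_\Omega\Big(\frac{\epsilon^2}2\lambda^n|\nabla\phi^n|^2+\lam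bda^nF(\phi^n)\Big)d\mathbf{x}+\sum_{i=1}^3\int_\Omega(c_i^n+1)\big(\ln(c_i^n+1)-1\big)d\mathbf{x}\\&+\int_\Omega(\phi^n)^2\big(M(c_2^n+1)+M(c_3^n+1)\big)d\mathbf{x}-\int_\Omega\frac{((\phi^n)^2-1)^2}4\big(N(c_2^n+1)+N(c_3^n+1)\big)d\mathbf{x}.\end{aligned}$$
   Context: $\Omega\subset\mathbb{R}^d$ ($d=2,3$) is a bounded domain with sufficiently regular boundary and outward unit normal $\mathbf{n}$. Constants: $Re,Pe,\epsilon>0$; $\mathcal{M}\ge0$; $M,N\ge0$; $D_2,D_3,D_1^+,D_1^->0$; $k\ge0$; stabilization parameter $S\ge0$; stoichiometric coefficients with $a_1+a_2=a_3$. $\lambda=\lambda(c_3)>0$ is a given $C^1$ function and $\lambda^n=\lambda(c_3^n)$. $P(\phi)=k(\phi^2-1)^2$ for $-1\le\phi\le1$ and $P(\phi)=0$ otherwise. The potential $F$ is the double well $\frac14(\phi^2-1)^2$ truncated to quadratic growth outside a bounded interval $[-M_0,M_0]$: $F\in C^2(\mathbb{R})$, $F(\phi)=\frac14(\phi^2-1)^2$ for $|\phi|\le M_0$ (some $M_0\ge 1$), and $L$ is a constant with $|F''(\phi)|\le L$ for all $\phi\in\mathbb{R}$. $q^n>0$ is the given permeability function at step $n$, and the coefficient $D_1^n$ below is positive. The scheme: given the quantities at step $n$ (with $\nabla\cdot\mathbf{u}^0=0$, $\mathbf{u}^0|_{\partial\Omega}=0$), those at step $n+1$ satisfy $$Re\Big(\frac{\mathbf{u}^{n+1}-\mathbf{u}^n}{\Delta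 t}+(\mathbf{u}^n\cdot\nabla)\mathbf{u}^{n+1}\Big)=\Delta\mathbf{u}^{n+1}-\nabla p^{n+1}-\phi^n\nabla\mu_\phi^{n+1}-\sum_{i=1}^3c_i^{n+1}\nabla\mu_i^{n+1},\qquad\nabla\cdot\mathbf{u}^{n+1}=0,$$ $$\frac{\phi^{n+1}-\phi^n}{\Delta t}+\nabla\cdot(\mathbf{u}^{n+1}\phi^n)=\nabla\cdot(\mathcal{M}\nabla\mu_\phi^{n+1}),$$ $$\begin{aligned}\mu_\phi^{n+1}=&-\epsilon^2\nabla\cdot(\lambda^n\nabla\phi^{n+1})+\lambda^nF'(\phi^n)+\lambda^nS(\phi^{n+1}-\phi^n)+2\phi^{n+1}\big(M(c_2^{n+1}+1)+M(c_3^{n+1}+1)\big)\\&-\big((\phi^n)^3-\phi^n\big)\big(N(c_2^n+1)+N(c_3^n+1)\big)+S(\phi^{n+1}-\phi^n)\big(N(c_2^n+1)+N(c_3^n+1)\big),\end{aligned}$$ $$\frac{c_1^{n+1}-c_1^n}{\Delta t}+\nabla\cdot(\mathbf{u}^{n+1}c_1^{n+1})=\frac1{Pe}\nabla\cdot\big(D_1^n(c_1^{n+1}+1)\nabla\mu_1^{n+1}\big)-a_1P(\phi^n)(a_1\mu_1^{n+1}+a_2\mu_2^{n+1}-a_3\mu_3^{n+1}),$$ $$\mu_1^{n+1}=\ln(c_1^{n+1}+1),\qquad\frac1{D_1^n}=\frac{((\phi^n)^2-1)^2}{q^n\epsilon}+\frac{1-\phi^n}{2D_1^-}+\frac{1+\phi^n}{2D_1^+},$$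 $$\frac{c_2^{n+1}-c_2^n}{\Delta t}+\nabla\cdot(\mathbf{u}^{n+1}c_2^{n+1})=\frac{D_2}{Pe}\nabla\cdot\big((c_2^{n+1}+1)\nabla\mu_2^{n+1}\big)-a_2P(\phi^n)(a_1\mu_1^{n+1}+a_2\mu_2^{n+1}-a_3\mu_3^{n+1}),$$ $$\mu_2^{n+1}=\ln(c_2^{n+1}+1)+M(\phi^n)^2-\frac N4\big((\phi^{n+1})^2-1\big)^2,$$ $$\frac{c_3^{n+1}-c_3^n}{\Delta t}+\nabla\cdot(\mathbf{u}^{n+1}c_3^{n+1})=\frac{D_3}{Pe}\nabla\cdot\big((c_3^{n+1}+1)\nabla\mu_3^{n+1}\big)+a_3P(\phi^n)(a_1\mu_1^{n+1}+a_2\mu_2^{n+1}-a_3\mu_3^{n+1}),$$ $$\mu_3^{n+1}=\frac{\lambda^{n+1}-\lambda^n}{c_3^{n+1}-c_3^n}\Big(F(\phi^{n+1})+\frac{\epsilon^2}2|\nabla\phi^{n+1}|^2\Big)+\ln(c_3^{n+1}+1)+M(\phi^n)^2-\frac N4\big((\phi^{n+1})^2-1\big)^2,$$ where the difference quotient is read as $\lambda'(c_3^n)$ at points where $c_3^{n+1}=c_3^n$. Boundary conditions on $\partial\Omega$: $\mathbf{u}^{n+1}=0$ and $\nabla\phi^{n+1}\cdot\mathbf{n}=\nabla\mu_\phi^{n+1}\cdot\mathbf{n}=\nabla c_i^{n+1}\cdot\mathbf{n}=\nabla\mu_i^{n+1}\cdot\mathbf{n}=0$, $i=1,2,3$. 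*)

theory Defs
  imports "HOL-Analysis.Analysis"
begin

primrec Ck_on :: "nat \<Rightarrow> 'a::euclidean_space set \<Rightarrow> ('a \<Rightarrow> 'b::real_normed_vector) \<Rightarrow> bool" where
  "Ck_on 0 U f \<longleftrightarrow> continuous_on U f"
| "Ck_on (Suc k) U f \<longleftrightarrow>
     (\<forall>x\<in>U. f differentiable (at x)) \<and> (\<forall>v. Ck_on k U (\<lambda>x. frechet_derivative f (at x) v))"

text \<open>The space of functions that are \<open>k\<close> times continuously differentiable up to the boundary
  of \<open>\<Omega>\<close>, rendered as the restrictions of \<open>C\<^sup>k\<close> functions on an open neighbourhood of the closure.
  For a bounded domain with \<open>C\<^sup>1\<close> boundary this is the usual space, by Whitney's extension theorem;
  the derivatives at boundary points are the limits of those in the interior, hence do not depend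
  on the extension.\<close>

definition Ck_closure :: "nat \<Rightarrow> 'a::euclidean_space set \<Rightarrow> ('a \<Rightarrow> 'b::real_normed_vector) \<Rightarrow> bool" where
  "Ck_closure k \<Omega> f \<longleftrightarrow> (\<exists>U. open U \<and> closure \<Omega> \<subseteq> U \<and> Ck_on k U f)"

definition grad :: "('a::euclidean_space \<Rightarrow> real) \<Rightarrow> 'a \<Rightarrow> 'a" where
  "grad f x = (\<Sum>b\<in>Basis. frechet_derivative f (at x) b *\<^sub>R b)"

definition divergence :: "('a::euclidean_space \<Rightarrow> 'a) \<Rightarrow> 'a \<Rightarrow> real" where
  "divergence V x = (\<Sum>b\<in>Basis. frechet_derivative V (at x) b \<bullet> b)"

definition vec_laplacian :: "('a::euclidean_space \<Rightarrow> 'a) \<Rightarrow> 'a \<Rightarrow> 'a" where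
  "vec_laplacian V x = (\<Sum>b\<in>Basis. divergence (grad (\<lambda>y. V y \<bullet> b)) x *\<^sub>R b)"

text \<open>\<open>(w \<cdot> \<nabla>) V\<close>, i.e. the derivative of \<open>V\<close> in direction \<open>w x\<close>.\<close>

definition advect :: "('a::euclidean_space \<Rightarrow> 'a) \<Rightarrow> ('a \<Rightarrow> 'a) \<Rightarrow> 'a \<Rightarrow> 'a" where
  "advect w V x = frechet_derivative V (at x) (w x)"

definition bounded_domain :: "'a::euclidean_space set \<Rightarrow> bool" where
  "bounded_domain \<Omega> \<longleftrightarrow> open \<Omega> \<and> connected \<Omega> \<and> \<Omega> \<noteq> {} \<and> bounded \<Omega>"

text \<open>\<open>\<rho>\<close> is a \<open>C\<^sup>1\<close> defining function of \<open>\<Omega>\<close> in the open set \<open>U\<close>. Since the gradient does not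
  vanish, the boundary of \<open>\<Omega>\<close> inside \<open>U\<close> is the zero set of \<open>\<rho>\<close>, \<open>\<Omega>\<close> lies on one side of it, and
  the gradient of \<open>\<rho>\<close> points out of \<open>\<Omega>\<close> there.\<close>

definition C1_defining_function ::
    "'a::euclidean_space set \<Rightarrow> 'a set \<Rightarrow> ('a \<Rightarrow> real) \<Rightarrow> bool" where
  "C1_defining_function \<Omega> U \<rho> \<longleftrightarrow>
     open U \<and> Ck_on 1 U \<rho> \<and> (\<forall>x\<in>U. grad \<rho> x \<noteq> 0) \<and> \<Omega> \<inter> U = {x\<in>U. \<rho> x < 0}"

text \<open>\<open>\<Omega>\<close> has a \<open>C\<^sup>1\<close> boundary, and \<open>\<nu>\<close> is its outward unit normal.\<close>

definition C1_boundary_normal :: "'a::euclidean_space set \<Rightarrow> ('a \<Rightarrow> 'a) \<Rightarrow> bool" where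
  "C1_boundary_normal \<Omega> \<nu> \<longleftrightarrow>
     (\<forall>x\<in>frontier \<Omega>. \<exists>U \<rho>. x \<in> U \<and> C1_defining_function \<Omega> U \<rho> \<and>
        \<nu> x = grad \<rho> x /\<^sub>R norm (grad \<rho> x))"

definition L2_norm :: "'a::euclidean_space set \<Rightarrow> ('a \<Rightarrow> 'b::real_normed_vector) \<Rightarrow> real" where
  "L2_norm \<Omega> f = sqrt (LINT x:\<Omega>|lborel. (norm (f x))\<^sup>2)"

definition reac :: "real \<Rightarrow> real \<Rightarrow> real" where
  "reac k s = (if -1 \<le> s \<and> s \<le> 1 then k * (s\<^sup>2 - 1)\<^sup>2 else 0)"

definition diff_quot :: "(real \<Rightarrow> real) \<Rightarrow> real \<Rightarrow> real \<Rightarrow> real" where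
  "diff_quot g s t = (if t = s then deriv g s else (g t - g s) / (t - s))"

definition energy ::
    "'a::euclidean_space set \<Rightarrow> real \<Rightarrow> real \<Rightarrow> (real \<Rightarrow> real) \<Rightarrow> (real \<Rightarrow> real) \<Rightarrow> real \<Rightarrow> real \<Rightarrow>
     ('a \<Rightarrow> 'a) \<Rightarrow> ('a \<Rightarrow> real) \<Rightarrow> ('a \<Rightarrow> real) \<Rightarrow> ('a \<Rightarrow> real) \<Rightarrow> ('a \<Rightarrow> real) \<Rightarrow> real" where
  "energy \<Omega> Rey eps lam F M N u \<phi> c1 c2 c3 =
     Rey / 2 * (L2_norm \<Omega> u)\<^sup>2
   + (LINT x:\<Omega>|lborel. eps\<^sup>2 / 2 * lam (c3 x) * (norm (grad \<phi> x))\<^sup>2 + lam (c3 x) * F (\<phi> x))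
   + (LINT x:\<Omega>|lborel. (c1 x + 1) * (ln (c1 x + 1) - 1))
   + (LINT x:\<Omega>|lborel. (c2 x + 1) * (ln (c2 x + 1) - 1))
   + (LINT x:\<Omega>|lborel. (c3 x + 1) * (ln (c3 x + 1) - 1))
   + (LINT x:\<Omega>|lborel. (\<phi> x)\<^sup>2 * (M * (c2 x + 1) + M * (c3 x + 1)))
   - (LINT x:\<Omega>|lborel. ((\<phi> x)\<^sup>2 - 1)\<^sup>2 / 4 * (N * (c2 x + 1) + N * (c3 x + 1)))"

end

theory Submission
  imports Defs
begin

text \<open>Testing the momentum equation with the new velocity and each transport equation with its chemical
  potential cancels all coupling terms up to divergences, and each term of the scheme is discretized so
  that convexity (of the entropy, the kinetic and the gradient energy) or the bound on second derivatives
  (of \<open>F\<close> and the double well, both absorbed by \<open>S\<close>) controls the energy increment. Thus, pointwise, the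
  increment of the energy density plus the dissipation is at most \<open>div V\<close> for a single \<open>C\<^sup>1\<close> field \<open>V\<close>
  that is tangential on the boundary. That \<open>S \<ge> 1/2\<close>, as needed for the double well in the coupling
  terms, follows from \<open>L \<ge> |F''(0)| = 1\<close>.

  That \<open>div V\<close> has integral zero is proved without surface measure: for compactly supported fields it is
  translation invariance of Lebesgue measure, and near the boundary one multiplies by a cut-off function
  of the defining function, where tangentiality makes the error term vanish in the limit.\<close>

subsection \<open>Calculus of \<open>C\<^sup>1\<close> functions and vector fields\<close>

text \<open>The coupled energy terms are products of a phase factor and a concentration factor, and
  the time levels in the potentials are those of a discrete product rule: the phase potential takes
  its concentration factor at one level, and the species potentials take the phase factor at the
  opposite one. The mixed increments then match exactly and only one-variable inequalities remain.
  For \<open>lam\<close> the difference quotient plays this role.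

  The claimed right-hand side has no viscous term. The viscous dissipation is nonnegative and is
  dropped together with the convexity remainders; all of them end up in the quantity T, which is
  obtained as the gap in an inequality.

  Positivity of \<open>c1 x + 1\<close> and its analogues is known only inside the open domain, so
  the logarithms may degenerate at the boundary. Hence the entropy is integrated by means of
  two-sided bounds, and the flux is written with the potentials, whose regularity up to the boundary
  is given, rather than with logarithms.\<close>

lemma Ck_on_1_iff:
  "Ck_on 1 U f \<longleftrightarrow>
    (\<forall>x\<in>U. f differentiable (at x)) \<and> (\<forall>v. continuous_on U (\<lambda>x. frechet_derivative f (at x) v))"
  by simp

lemma Ck_on_1I:
  assumes "\<And>x. x \<in> U \<Longrightarrow> (f has_derivative f' x) (at x)" "\<And>v. continuous_on U (\<lambda>x. f' x v)"
  shows "Ck_on 1 U f"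
proof -
  have eq: "frechet_derivative f (at x) = f' x" if "x \<in> U" for x
    using assms(1)[OF that] by (metis frechet_derivative_at)
  show ?thesis
    unfolding Ck_on_1_iff
    using assms by (auto simp: differentiable_def eq cong: continuous_on_cong)
qed

lemma Ck_on_1D:
  assumes "Ck_on 1 U f"
  shows "x \<in> U \<Longrightarrow> (f has_derivative frechet_derivative f (at x)) (at x)"
    and "continuous_on U (\<lambda>x. frechet_derivative f (at x) v)"
  using assms unfolding Ck_on_1_iff by (auto simp: frechet_derivative_works)

lemma Ck_on_1_differentiable: "Ck_on 1 U f \<Longrightarrow> x \<in> U \<Longrightarrow> f differentiable (at x)"
  by simp

lemma Ck_on_1_continuous_on: "Ck_on 1 U f \<Longrightarrow> continuous_on U f"
  by (meson Ck_on_1_differentiable continuous_at_imp_continuous_on differentiable_imp_continuous_within)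

lemma Ck_on_subset: "Ck_on k U f \<Longrightarrow> T \<subseteq> U \<Longrightarrow> Ck_on k T f"
  by (induction k arbitrary: f) (auto intro: continuous_on_subset)

lemma Ck_on_2D:
  assumes "Ck_on 2 U f"
  shows "Ck_on 1 U (\<lambda>x. frechet_derivative f (at x) v)" "Ck_on 1 U f"
proof -
  show *: "Ck_on 1 U (\<lambda>x. frechet_derivative f (at x) v)" for v
    using assms by (simp add: numeral_2_eq_2)
  show "Ck_on 1 U f"
    using assms Ck_on_1_continuous_on[OF *] by (simp add: numeral_2_eq_2)
qed

lemma Ck_on_1_const: "Ck_on 1 U (\<lambda>x. c)"
  by (rule Ck_on_1I[where f' = "\<lambda>_ _. 0"]) auto

lemma Ck_on_1_bilinear:
  assumes "bounded_bilinear pr" "Ck_on 1 U f" "Ck_on 1 U g"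
  shows "Ck_on 1 U (\<lambda>x. pr (f x) (g x))"
proof (rule Ck_on_1I)
  show "((\<lambda>x. pr (f x) (g x)) has_derivative
      (\<lambda>v. pr (f x) (frechet_derivative g (at x) v) + pr (frechet_derivative f (at x) v) (g x))) (at x)"
    if "x \<in> U" for x
    by (intro bounded_bilinear.FDERIV assms(1) Ck_on_1D(1)[OF _ that] assms(2,3))
  show "continuous_on U (\<lambda>x. pr (f x) (frechet_derivative g (at x) v) + pr (frechet_derivative f (at x) v) (g x))" for v
    by (intro continuous_on_add bounded_bilinear.continuous_on[OF assms(1)]
        Ck_on_1_continuous_on assms(2,3) Ck_on_1D(2))
qed

lemmas Ck_on_1_scaleR = Ck_on_1_bilinear[OF bounded_bilinear_scaleR]
lemmas Ck_on_1_inner = Ck_on_1_bilinear[OF bounded_bilinear_inner]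
lemmas Ck_on_1_mult = Ck_on_1_bilinear[OF bounded_bilinear_mult]

lemma Ck_on_1_add:
  assumes "Ck_on 1 U f" "Ck_on 1 U g"
  shows "Ck_on 1 U (\<lambda>x. f x + g x)"
proof (rule Ck_on_1I)
  show "((\<lambda>x. f x + g x) has_derivative
      (\<lambda>v. frechet_derivative f (at x) v + frechet_derivative g (at x) v)) (at x)" if "x \<in> U" for x
    by (intro has_derivative_add Ck_on_1D(1)[OF _ that] assms)
qed (intro continuous_on_add Ck_on_1D(2) assms)

lemma Ck_on_1_uminus:
  assumes "Ck_on 1 U f"
  shows "Ck_on 1 U (\<lambda>x. - f x)"
proof (rule Ck_on_1I)
  show "((\<lambda>x. - f x) has_derivative (\<lambda>v. - frechet_derivative f (at x) v)) (at x)" if "x \<in> U" for x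
    by (intro has_derivative_minus Ck_on_1D(1)[OF _ that] assms)
qed (intro continuous_on_minus Ck_on_1D(2) assms)

lemma Ck_on_1_diff:
  assumes "Ck_on 1 U f" "Ck_on 1 U g"
  shows "Ck_on 1 U (\<lambda>x. f x - g x)"
  using Ck_on_1_add[OF assms(1) Ck_on_1_uminus[OF assms(2)]] by simp

lemma Ck_on_1_sum:
  assumes "\<And>i. i \<in> I \<Longrightarrow> Ck_on 1 U (f i)"
  shows "Ck_on 1 U (\<lambda>x. \<Sum>i\<in>I. f i x)"
  using assms
proof (induction I rule: infinite_finite_induct)
  case (insert i I)
  then show ?case by (simp only: sum.insert not_False_eq_True if_True, intro Ck_on_1_add) auto
qed (simp_all only: sum.infinite sum.empty Ck_on_1_const not_False_eq_True)

text \<open>The outer function is restricted to a set \<open>T\<close> containing the range, so that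
  \<open>inverse\<close> on the positive reals qualifies; this normalizes the partition of unity
  later.\<close>

lemma Ck_on_1_compose:
  fixes f :: "'a::euclidean_space \<Rightarrow> real"
  assumes "\<And>s. s \<in> T \<Longrightarrow> (g has_field_derivative g' s) (at s)" "continuous_on T g'"
    and "Ck_on 1 U f" "f ` U \<subseteq> T"
  shows "Ck_on 1 U (\<lambda>x. g (f x))"
proof (rule Ck_on_1I)
  show "((\<lambda>x. g (f x)) has_derivative (\<lambda>v. g' (f x) * frechet_derivative f (at x) v)) (at x)"
    if "x \<in> U" for x
    using has_derivative_compose[OF Ck_on_1D(1)[OF assms(3) that], of g "(*) (g' (f x))"]
      assms(1)[of "f x"] that assms(4) by (auto simp: has_field_derivative_def o_def)
  have "continuous_on U (\<lambda>x. g' (f x))"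
    by (rule continuous_on_compose2[OF assms(2) Ck_on_1_continuous_on[OF assms(3)] assms(4)])
  then show "continuous_on U (\<lambda>x. g' (f x) * frechet_derivative f (at x) v)" for v
    by (intro continuous_on_mult Ck_on_1D(2)[OF assms(3)])
qed

lemma Ck_on_1_norm_power2:
  "Ck_on 1 U (\<lambda>x :: 'a :: euclidean_space. (norm (x - a))\<^sup>2)"
  unfolding power2_norm_eq_inner
  by (rule Ck_on_1I[where f' = "\<lambda>x v. (x - a) \<bullet> v + v \<bullet> (x - a)"])
    (auto intro!: derivative_eq_intros continuous_intros)

lemma Ck_on_1_real:
  assumes "Ck_on 1 UNIV (g :: real \<Rightarrow> real)"
  shows "(g has_field_derivative deriv g s) (at s)" "continuous_on T (deriv g)"
proof -
  show *: "(g has_field_derivative deriv g s) (at s)" for s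
    using Ck_on_1_differentiable[OF assms, of s]
    by (simp add: DERIV_deriv_iff_real_differentiable)
  have "frechet_derivative g (at s) 1 = deriv g s" for s
    using frechet_derivative_at[OF *[unfolded has_field_derivative_def]] by (metis mult_1_right)
  then show "continuous_on T (deriv g)"
    using Ck_on_1D(2)[OF assms, of 1] continuous_on_subset[OF _ subset_UNIV] by auto
qed

lemma inner_grad:
  assumes "f differentiable (at x)"
  shows "grad f x \<bullet> v = frechet_derivative f (at x) v"
proof -
  interpret linear "frechet_derivative f (at x)"
    by (rule linear_frechet_derivative[OF assms])
  have "frechet_derivative f (at x) v = frechet_derivative f (at x) (\<Sum>b\<in>Basis. (v \<bullet> b) *\<^sub>R b)"
    by (simp add: euclidean_representation)
  also have "\<dots> = grad f x \<bullet> v"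
    by (simp add: sum scale grad_def inner_sum_left inner_commute[of v] mult.commute)
  finally show ?thesis ..
qed

lemma Ck_on_1_grad: "Ck_on 2 U f \<Longrightarrow> Ck_on 1 U (grad f)"
  unfolding grad_def by (intro Ck_on_1_sum Ck_on_1_scaleR Ck_on_1_const Ck_on_2D)

lemma Ck_on_1_cong_open:
  assumes "open U" "\<And>x. x \<in> U \<Longrightarrow> f x = g x" "Ck_on 1 U f"
  shows "Ck_on 1 U g"
proof (rule Ck_on_1I)
  show "(g has_derivative frechet_derivative f (at x)) (at x)" if "x \<in> U" for x
    using has_derivative_transform_within_open[OF Ck_on_1D(1)[OF assms(3) that] assms(1) that] assms(2)
    by simp
qed (rule Ck_on_1D(2)[OF assms(3)])

text \<open>\<open>vec_laplacian\<close> takes the gradient of each velocity component and then a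
  divergence, so it is the components that must inherit second-order regularity.\<close>

lemma Ck_on_2_inner_const:
  assumes "open U" "Ck_on 2 U f"
  shows "Ck_on 2 U (\<lambda>x. f x \<bullet> b)"
proof -
  have d: "f differentiable at x" if "x \<in> U" for x
    using assms that by (simp add: numeral_2_eq_2)
  have eq: "frechet_derivative (\<lambda>x. f x \<bullet> b) (at x) = (\<lambda>v. frechet_derivative f (at x) v \<bullet> b)"
    if "x \<in> U" for x
    by (rule frechet_derivative_at[symmetric])
      (auto intro!: derivative_eq_intros frechet_derivative_works[THEN iffD1] d that)
  have *: "Ck_on 1 U (\<lambda>x. frechet_derivative f (at x) v \<bullet> b)" for v
    by (intro Ck_on_1_inner Ck_on_2D(1) assms Ck_on_1_const)
  have "Ck_on 1 U (\<lambda>x. frechet_derivative (\<lambda>x. f x \<bullet> b) (at x) v)" for v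
    by (rule Ck_on_1_cong_open[OF assms(1) _ *[of v]]) (simp add: eq)
  moreover have "\<forall>x\<in>U. (\<lambda>x. f x \<bullet> b) differentiable at x"
    using d by (intro ballI differentiable_inner differentiable_const)
  ultimately show ?thesis
    unfolding numeral_2_eq_2 Ck_on.simps(2)[of "Suc 0"] by (simp only: One_nat_def simp_thms)
qed

lemma continuous_on_grad:
  assumes "Ck_on 1 U f"
  shows "continuous_on U (grad f)"
  unfolding grad_def by (intro continuous_on_sum continuous_on_scaleR continuous_on_const Ck_on_1D(2) assms)

lemma continuous_on_divergence:
  assumes "Ck_on 1 U V"
  shows "continuous_on U (divergence V)"
  unfolding divergence_def by (intro continuous_on_sum continuous_on_inner continuous_on_const Ck_on_1D(2) assms)

lemma divergence_at:
  assumes "(V has_derivative V') (at x)"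
  shows "divergence V x = (\<Sum>b\<in>Basis. V' b \<bullet> b)"
  unfolding divergence_def using frechet_derivative_at[OF assms] by simp

lemma divergence_add:
  assumes "V differentiable (at x)" "W differentiable (at x)"
  shows "divergence (\<lambda>y. V y + W y) x = divergence V x + divergence W x"
  by (subst divergence_at[OF has_derivative_add[OF assms[THEN frechet_derivative_works[THEN iffD1]]]])
    (simp add: inner_add_left sum.distrib divergence_def)

lemma divergence_diff:
  assumes "V differentiable (at x)" "W differentiable (at x)"
  shows "divergence (\<lambda>y. V y - W y) x = divergence V x - divergence W x"
  by (subst divergence_at[OF has_derivative_diff[OF assms[THEN frechet_derivative_works[THEN iffD1]]]])
    (simp add: inner_diff_left sum_subtractf divergence_def)

lemma divergence_sum:
  assumes "\<And>i. i \<in> I \<Longrightarrow> V i differentiable (at x)"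
  shows "divergence (\<lambda>y. \<Sum>i\<in>I. V i y) x = (\<Sum>i\<in>I. divergence (V i) x)"
  by (subst divergence_at[OF has_derivative_sum[OF assms[THEN frechet_derivative_works[THEN iffD1]]]])
    (simp_all add: inner_sum_left divergence_def sum.swap[of _ Basis])

lemma divergence_scaleR:
  assumes "f differentiable (at x)" "V differentiable (at x)"
  shows "divergence (\<lambda>y. f y *\<^sub>R V y) x = f x * divergence V x + grad f x \<bullet> V x"
proof -
  have "divergence (\<lambda>y. f y *\<^sub>R V y) x
    = (\<Sum>b\<in>Basis. f x * (frechet_derivative V (at x) b \<bullet> b) + frechet_derivative f (at x) b * (V x \<bullet> b))"
    by (subst divergence_at[OF has_derivative_scaleR[OF assms[THEN frechet_derivative_works[THEN iffD1]]]])
      (simp add: inner_add_left)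
  also have "\<dots> = f x * divergence V x + grad f x \<bullet> V x"
    by (simp add: sum.distrib divergence_def grad_def sum_distrib_left inner_sum_left inner_commute[of "V x"])
  finally show ?thesis .
qed

lemma divergence_const_scaleR:
  assumes "V differentiable (at x)"
  shows "divergence (\<lambda>y. c *\<^sub>R V y) x = c * divergence V x"
  by (subst divergence_at[OF has_derivative_scaleR_right[OF frechet_derivative_works[THEN iffD1, OF assms]]])
    (simp add: sum_distrib_left divergence_def)

text \<open>\<open>frechet_derivative\<close> is a choice from the set of derivatives at
  \<open>x\<close>, and fields that agree near \<open>x\<close> have the same set.\<close>

lemma divergence_cong_open:
  assumes "open T" "x \<in> T" "\<And>y. y \<in> T \<Longrightarrow> V y = W y"
  shows "divergence V x = divergence W x"
proof -
  have "(V has_derivative D) (at x) \<longleftrightarrow> (W has_derivative D) (at x)" for D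
    using assms has_derivative_transform_within_open[of V D x UNIV T W]
      has_derivative_transform_within_open[of W D x UNIV T V] by auto
  then show ?thesis
    unfolding divergence_def frechet_derivative_def by simp
qed

subsection \<open>The divergence theorem for tangential fields\<close>

lemma integrable_compact_support:
  fixes f :: "'a::euclidean_space \<Rightarrow> real"
  assumes "compact K" "continuous_on K f" "\<And>x. x \<notin> K \<Longrightarrow> f x = 0"
  shows "integrable lborel f"
proof -
  have "(\<lambda>x. indicator K x *\<^sub>R f x) = f"
    using assms(3) by (intro ext) (auto simp: indicator_def)
  then show ?thesis
    using borel_integrable_compact[OF assms(1,2)] by simp
qed

lemma lborel_integral_translate:
  fixes f :: "'a::euclidean_space \<Rightarrow> real"
  assumes "f \<in> borel_measurable borel"
  shows "(\<integral>x. f (x + c) \<partial>lborel) = (\<integral>x. f x \<partial>lborel)"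
    and "integrable lborel f \<Longrightarrow> integrable lborel (\<lambda>x. f (x + c))"
proof -
  show "(\<integral>x. f (x + c) \<partial>lborel) = (\<integral>x. f x \<partial>lborel)"
    using integral_distr[of "(+) c" lborel borel f] assms lborel_distr_plus[of c]
    by (simp add: add.commute)
  show "integrable lborel (\<lambda>x. f (x + c))" if "integrable lborel f"
    using integrable_distr_eq[of "(+) c" lborel borel f] assms lborel_distr_plus[of c] that
    by (simp add: add.commute)
qed

lemma frechet_derivative_eq_0_open:
  assumes "open T" "x \<in> T" "\<And>y. y \<in> T \<Longrightarrow> f y = 0"
  shows "frechet_derivative f (at x) v = 0"
proof -
  have "(f has_derivative (\<lambda>_. 0)) (at x)"
    by (rule has_derivative_transform_within_open[OF has_derivative_const assms(1,2)])
      (simp add: assms(3))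
  from frechet_derivative_at[OF this] show ?thesis
    by metis
qed

text \<open>The difference quotients of \<open>f\<close> in direction \<open>v\<close> have integral zero by translation invariance
  of Lebesgue measure, and converge dominatedly.\<close>

lemma integral_directional_derivative_eq_0:
  fixes f :: "'a::euclidean_space \<Rightarrow> real"
  assumes C: "Ck_on 1 UNIV f" and K: "compact K" and z: "\<And>x. x \<notin> K \<Longrightarrow> f x = 0"
  shows "(\<integral>x. frechet_derivative f (at x) v \<partial>lborel) = 0"
proof -
  define D where "D = (\<lambda>x. frechet_derivative f (at x) v)"
  define t where "t = (\<lambda>n. inverse (real (Suc n)))"
  define s where "s = (\<lambda>n x. (f (x + t n *\<^sub>R v) - f x) / t n)"
  have t: "0 < t n" "t n \<le> 1" for n
    by (simp_all add: t_def field_simps)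
  have D0: "D x = 0" if "x \<notin> K" for x
    unfolding D_def by (rule frechet_derivative_eq_0_open[of "- K"])
      (use that z K in \<open>auto simp: open_Compl compact_imp_closed\<close>)
  have contD: "continuous_on UNIV D"
    unfolding D_def by (rule Ck_on_1D(2)[OF C])
  have "bounded (D ` K)"
    by (intro compact_imp_bounded compact_continuous_image continuous_on_subset[OF contD] K) simp
  then obtain B where "B > 0" and B: "\<And>x. x \<in> K \<Longrightarrow> norm (D x) \<le> B"
    unfolding bounded_pos by auto
  have B: "norm (D x) \<le> B" for x
    using B D0 \<open>B > 0\<close> by (cases "x \<in> K") auto
  have g: "((\<lambda>a. f (x + a *\<^sub>R v)) has_field_derivative D (x + a *\<^sub>R v)) (at a)" for x a
  proof -
    have "((\<lambda>a. f (x + a *\<^sub>R v)) has_derivative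
        (\<lambda>b. frechet_derivative f (at (x + a *\<^sub>R v)) (b *\<^sub>R v))) (at a)"
      by (rule has_derivative_compose[OF _ Ck_on_1D(1)[OF C UNIV_I], where f = "\<lambda>a. x + a *\<^sub>R v"])
        (auto intro!: derivative_eq_intros)
    moreover have "frechet_derivative f (at y) (b *\<^sub>R v) = D y * b" for y b
      using linear_frechet_derivative[OF Ck_on_1_differentiable[OF C UNIV_I], of y]
      by (simp add: D_def linear_cmul)
    ultimately show ?thesis
      by (simp add: has_field_derivative_def)
  qed
  have lip: "norm (s n x) \<le> B" for n x
  proof -
    have "norm (f (x + t n *\<^sub>R v) - f (x + 0 *\<^sub>R v)) \<le> B * norm (t n - 0)"
      by (rule field_differentiable_bound[of UNIV "\<lambda>a. f (x + a *\<^sub>R v)"])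
        (use g B in \<open>auto\<close>)
    then show ?thesis
      using t[of n] by (simp add: s_def divide_le_eq)
  qed
  obtain r where r: "\<And>x. x \<in> K \<Longrightarrow> norm x \<le> r"
    using compact_imp_bounded[OF K] unfolding bounded_iff by auto
  \<comment> \<open>Because \<open>t n \<le> 1\<close>, the shift moves points by at most
    \<open>norm v\<close>. Outside this radius both \<open>x\<close> and its shift miss
    \<open>K\<close>, which gives one dominating function for all \<open>n\<close>.\<close>
  define R where "R = r + norm v"
  have s0: "s n x = 0" if "x \<notin> cball 0 R" for n x
  proof -
    have "norm x > r + norm v" using that by (simp add: R_def)
    moreover have "norm (t n *\<^sub>R v) \<le> norm v"
      using t[of n] by (simp add: mult_left_le_one_le)
    moreover have "norm (x + t n *\<^sub>R v) \<ge> norm x - norm (t n *\<^sub>R v)"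
      by (metis norm_diff_ineq)
    ultimately have "x \<notin> K" "x + t n *\<^sub>R v \<notin> K"
      using r[of x] r[of "x + t n *\<^sub>R v"] norm_ge_zero[of v] by linarith+
    then show ?thesis by (simp add: s_def z)
  qed
  have contf: "continuous_on UNIV f"
    by (rule Ck_on_1_continuous_on[OF C])
  have mf: "f \<in> borel_measurable borel"
    using contf by (rule borel_measurable_continuous_onI)
  have intf: "integrable lborel f"
    by (rule integrable_compact_support[OF K continuous_on_subset[OF contf] z]) auto
  have "(\<lambda>n. \<integral>x. s n x \<partial>lborel) \<longlonglongrightarrow> (\<integral>x. D x \<partial>lborel)"
  proof (rule integral_dominated_convergence[where w = "\<lambda>x. indicator (cball 0 R) x * B"])
    show "D \<in> borel_measurable lborel"
      using borel_measurable_continuous_onI[OF contD] by simp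
    show "s n \<in> borel_measurable lborel" for n
      unfolding s_def
      by (simp, intro borel_measurable_continuous_onI continuous_intros
          continuous_on_compose2[OF contf]) (use t(1)[of n] in auto)
    show "integrable lborel (\<lambda>x::'a. indicator (cball 0 R) x * B)"
      using borel_integrable_compact[of "cball 0 R" "\<lambda>_. B"] by simp
    show "AE x in lborel. (\<lambda>n. s n x) \<longlonglongrightarrow> D x"
    proof (rule AE_I2)
      fix x
      have "((\<lambda>h. (f (x + h *\<^sub>R v) - f x) / h) \<longlongrightarrow> D x) (at 0)"
        using g[of x 0] by (simp add: DERIV_def)
      moreover have "filterlim t (at 0) sequentially"
        unfolding filterlim_at t_def by (intro conjI LIMSEQ_inverse_real_of_nat) (simp add: t_def)
      ultimately show "(\<lambda>n. s n x) \<longlonglongrightarrow> D x"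
        unfolding s_def by (rule filterlim_compose)
    qed
    show "AE x in lborel. norm (s n x) \<le> indicator (cball 0 R) x * B" for n
      using lip s0 by (intro AE_I2) (auto simp: indicator_def)
  qed
  moreover have "(\<integral>x. s n x \<partial>lborel) = 0" for n
    unfolding s_def using lborel_integral_translate[OF mf, of "t n *\<^sub>R v"] intf
    by simp
  ultimately have "(\<lambda>n. 0) \<longlonglongrightarrow> (\<integral>x. D x \<partial>lborel)"
    by simp
  then show ?thesis
    unfolding D_def by (simp add: LIMSEQ_const_iff)
qed

text \<open>The open sets \<open>U\<close> and \<open>- K\<close> cover the space. The extension is
  \<open>f\<close> on the first and zero on the second, and both differentiability and continuity of
  the derivative are local.\<close>

lemma Ck_on_1_extend_0:
  assumes "open U" "compact K" "K \<subseteq> U" "Ck_on 1 U f" "\<And>x. x \<in> U - K \<Longrightarrow> f x = 0"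
  shows "Ck_on 1 UNIV (\<lambda>x. if x \<in> U then f x else 0)"
proof (rule Ck_on_1I)
  let ?f = "\<lambda>x. if x \<in> U then f x else 0"
  let ?D = "\<lambda>x v. if x \<in> U then frechet_derivative f (at x) v else 0"
  have oK: "open (- K)" using assms(2) by (simp add: compact_imp_closed open_Compl)
  show "(?f has_derivative ?D x) (at x)" for x
  proof (cases "x \<in> U")
    case True
    have "(?f has_derivative frechet_derivative f (at x)) (at x)"
      by (rule has_derivative_transform_within_open[OF Ck_on_1D(1)[OF assms(4) True] assms(1) True]) simp
    then show ?thesis using True by simp
  next
    case False
    have "(?f has_derivative (\<lambda>_. 0)) (at x)"
      by (rule has_derivative_transform_within_open[OF has_derivative_const oK])
        (use False assms in auto)
    then show ?thesis using False by simp
  qed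
  have "continuous_on (U \<union> - K) (\<lambda>x. ?D x v)" for v
  proof (rule continuous_on_open_Un[OF assms(1) oK])
    show "continuous_on U (\<lambda>x. ?D x v)"
      using Ck_on_1D(2)[OF assms(4), of v] by (simp cong: continuous_on_cong)
    have "?D x v = 0" if "x \<in> - K" for x
      using frechet_derivative_eq_0_open[of "U - K" x f v] that assms(1,2,5)
      by (auto simp: open_Diff compact_imp_closed)
    then show "continuous_on (- K) (\<lambda>x. ?D x v)"
      by (subst continuous_on_cong[OF refl]) auto
  qed
  moreover have "U \<union> - K = UNIV" using assms(3) by auto
  ultimately show "continuous_on UNIV (\<lambda>x. ?D x v)" for v by simp
qed

lemma divergence_eq_0_open:
  assumes "open T" "x \<in> T" "\<And>y. y \<in> T \<Longrightarrow> V y = 0"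
  shows "divergence V x = 0"
  unfolding divergence_def using frechet_derivative_eq_0_open[OF assms] by simp

lemma set_integrable_vanishing_outside_compact:
  fixes f :: "'a::euclidean_space \<Rightarrow> real"
  assumes "open U" "compact K" "K \<subseteq> U" "continuous_on U f" "\<And>x. x \<in> U - K \<Longrightarrow> f x = 0"
  shows "set_integrable lborel U f"
  unfolding set_integrable_def
  by (rule integrable_compact_support[OF assms(2)])
    (use assms in \<open>auto simp: indicator_def subset_iff intro!: continuous_on_subset[of U f K] cong: continuous_on_cong\<close>)

text \<open>After extension by zero, the divergence is a sum of directional derivatives of compactly
  supported components, each of which integrates to zero.\<close>

lemma integral_divergence_compact_support:
  assumes U: "open U" and K: "compact K" "K \<subseteq> U" and V: "Ck_on 1 U V" "\<And>x. x \<in> U - K \<Longrightarrow> V x = 0"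
  shows "set_integrable lborel U (divergence V)" "(LINT x:U|lborel. divergence V x) = 0"
proof -
  have div0: "divergence V x = 0" if "x \<in> U - K" for x
    by (rule divergence_eq_0_open[of "U - K"]) (use that U K V(2) in \<open>auto simp: open_Diff compact_imp_closed\<close>)
  show "set_integrable lborel U (divergence V)"
    by (rule set_integrable_vanishing_outside_compact[OF U K continuous_on_divergence[OF V(1)] div0])
  define W where "W = (\<lambda>x. if x \<in> U then V x else 0)"
  have W: "Ck_on 1 UNIV W"
    unfolding W_def by (rule Ck_on_1_extend_0[OF U K V])
  have WK: "W x = 0" if "x \<notin> K" for x
    using V(2) that by (auto simp: W_def)
  have comp: "frechet_derivative (\<lambda>y. W y \<bullet> b) (at x) v = frechet_derivative W (at x) v \<bullet> b" for b v x
  proof -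
    have "((\<lambda>y. W y \<bullet> b) has_derivative (\<lambda>v. frechet_derivative W (at x) v \<bullet> b)) (at x)"
      by (intro has_derivative_inner_left Ck_on_1D(1)[OF W] UNIV_I)
    from frechet_derivative_at[OF this] show ?thesis by metis
  qed
  have divW: "divergence W x = indicator U x *\<^sub>R divergence V x" for x
  proof (cases "x \<in> U")
    case True
    then show ?thesis
      using divergence_cong_open[OF U True, of W V] by (simp add: W_def)
  next
    case False
    then show ?thesis
      using divergence_eq_0_open[of "- K" x W] K WK by (auto simp: compact_imp_closed open_Compl)
  qed
  have int: "integrable lborel (\<lambda>x. frechet_derivative W (at x) b \<bullet> b)" for b
  proof (rule integrable_compact_support[OF K(1)])
    show "continuous_on K (\<lambda>x. frechet_derivative W (at x) b \<bullet> b)"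
      by (intro continuous_intros continuous_on_subset[OF Ck_on_1D(2)[OF W]]) simp
    show "frechet_derivative W (at x) b \<bullet> b = 0" if "x \<notin> K" for x
      using frechet_derivative_eq_0_open[of "- K" x W b] WK K that
      by (auto simp: compact_imp_closed open_Compl)
  qed
  have "(LINT x:U|lborel. divergence V x) = (\<integral>x. divergence W x \<partial>lborel)"
    by (simp add: set_lebesgue_integral_def divW)
  also have "\<dots> = (\<Sum>b\<in>Basis. \<integral>x. frechet_derivative W (at x) b \<bullet> b \<partial>lborel)"
    unfolding divergence_def by (rule Bochner_Integration.integral_sum[OF int])
  also have "\<dots> = 0"
    using integral_directional_derivative_eq_0[OF Ck_on_1_inner[OF W Ck_on_1_const] K(1)]
    by (intro sum.neutral) (simp add: WK flip: comp)
  finally show "(LINT x:U|lborel. divergence V x) = 0" .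
qed

section \<open>A quadratic cut-off\<close>

text \<open>An elementary \<open>C\<^sup>1\<close> function that vanishes on one half-line and is
  positive on the other. The cut-off, the bump functions of the partition of unity and a closed
  formula for \<open>reac\<close> are all built from it.\<close>

definition pos_sq :: "real \<Rightarrow> real" where
  "pos_sq s = (max 0 s)\<^sup>2"

lemma DERIV_pos_sq: "(pos_sq has_field_derivative 2 * max 0 s) (at s)"
proof (cases s "0 :: real" rule: linorder_cases)
  case less
  have "((\<lambda>_. 0) has_field_derivative 0) (at s)" by simp
  then have "(pos_sq has_field_derivative 0) (at s)"
    by (rule has_field_derivative_transform_within_open[of _ _ _ "{..<0}"]) (use less in \<open>auto simp: pos_sq_def max_def\<close>)
  then show ?thesis using less by simp
next
  case greater
  have "((\<lambda>s. s\<^sup>2) has_field_derivative 2 * s) (at s)" by (auto intro!: derivative_eq_intros)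
  then have "(pos_sq has_field_derivative 2 * s) (at s)"
    by (rule has_field_derivative_transform_within_open[of _ _ _ "{0<..}"]) (use greater in \<open>auto simp: pos_sq_def max_def\<close>)
  then show ?thesis using greater by simp
next
  case equal
  have "((\<lambda>h. pos_sq h / h) \<longlongrightarrow> 0) (at 0)"
    by (rule Lim_null_comparison[of _ "\<lambda>h. \<bar>h\<bar>"])
      (auto simp: pos_sq_def max_def power2_eq_square intro!: tendsto_rabs_zero always_eventually)
  then show ?thesis by (simp add: equal DERIV_def pos_sq_def)
qed

lemma pos_sq_nonneg: "0 \<le> pos_sq s"
  by (simp add: pos_sq_def)

lemma pos_sq_eq_0: "s \<le> 0 \<Longrightarrow> pos_sq s = 0"
  by (simp add: pos_sq_def)

lemma pos_sq_pos: "0 < s \<Longrightarrow> 0 < pos_sq s"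
  by (simp add: pos_sq_def)

lemma one_le_pos_sq: "1 \<le> s \<Longrightarrow> 1 \<le> pos_sq s"
  by (simp add: pos_sq_def)

lemma Ck_on_1_pos_sq: "Ck_on 1 U f \<Longrightarrow> Ck_on 1 U (\<lambda>x. pos_sq (f x))"
  by (rule Ck_on_1_compose[of UNIV pos_sq "\<lambda>s. 2 * max 0 s"]) (auto intro!: DERIV_pos_sq continuous_intros)

text \<open>A \<open>C\<^sup>1\<close> decreasing step from \<open>1\<close> on \<open>(-\<infinity>, -1]\<close> down to \<open>0\<close> on \<open>[0, \<infinity>)\<close>.\<close>

definition cutoff :: "real \<Rightarrow> real" where
  "cutoff s = pos_sq (1 - pos_sq (s + 1))"

definition cutoff_deriv :: "real \<Rightarrow> real" where
  "cutoff_deriv s = - 4 * max 0 (1 - pos_sq (s + 1)) * max 0 (s + 1)"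

lemma DERIV_cutoff: "(cutoff has_field_derivative cutoff_deriv s) (at s)"
proof -
  have "((\<lambda>s. 1 - pos_sq (s + 1)) has_field_derivative 0 - 2 * max 0 (s + 1) * (1 + 0)) (at s)"
    by (intro DERIV_diff DERIV_const DERIV_chain2[OF DERIV_pos_sq] DERIV_add DERIV_ident)
  from DERIV_chain2[OF DERIV_pos_sq this] show ?thesis
    unfolding cutoff_def cutoff_deriv_def by (rule DERIV_cong) simp
qed

lemma continuous_cutoff_deriv: "continuous_on T cutoff_deriv"
  unfolding cutoff_deriv_def pos_sq_def by (intro continuous_intros)

lemma cutoff_bounds: "0 \<le> cutoff s" "cutoff s \<le> 1"
  unfolding cutoff_def pos_sq_def[of "1 - _"]
  by (auto intro!: power_le_one simp: pos_sq_nonneg)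

lemma cutoff_eq_1: "s \<le> - 1 \<Longrightarrow> cutoff s = 1"
  by (simp add: cutoff_def pos_sq_eq_0) (simp add: pos_sq_def)

lemma cutoff_eq_0: "0 \<le> s \<Longrightarrow> cutoff s = 0"
  using one_le_pos_sq[of "s + 1"] by (simp add: cutoff_def pos_sq_eq_0)

lemma cutoff_deriv_nonpos: "cutoff_deriv s \<le> 0"
  by (simp add: cutoff_deriv_def)

lemma cutoff_deriv_eq_0:
  assumes "s \<le> - 1 \<or> 0 \<le> s"
  shows "cutoff_deriv s = 0"
  using assms
proof
  assume "0 \<le> s"
  then show ?thesis
    using one_le_pos_sq[of "s + 1"] by (simp add: cutoff_deriv_def)
qed (simp add: cutoff_deriv_def)

lemma grad_compose:
  assumes "(g has_field_derivative g') (at (f x))" "f differentiable (at x)"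
  shows "grad (\<lambda>y. g (f y)) x = g' *\<^sub>R grad f x"
proof -
  have "((\<lambda>y. g (f y)) has_derivative (\<lambda>v. g' * frechet_derivative f (at x) v)) (at x)"
    using has_derivative_compose[of f _ x UNIV g "(*) g'"] assms
    by (simp add: has_field_derivative_def frechet_derivative_works)
  from frechet_derivative_at[OF this] show ?thesis
    unfolding grad_def scaleR_sum_right by (metis scaleR_scaleR)
qed

section \<open>Tangential fields near the boundary\<close>

context
  fixes U K :: "'a::euclidean_space set" and \<rho> :: "'a \<Rightarrow> real"
  assumes U: "open U" and K: "compact K" "K \<subseteq> U" and \<rho>: "Ck_on 1 U \<rho>"
begin

text \<open>The product of the cut-off and \<open>G\<close> is supported in \<open>K\<close>, so its
  divergence integrates to zero over \<open>U\<close>; the product rule splits that divergence into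
  the two integrands. Integration runs over both sides of the boundary, and the restriction to
  \<open>\<Omega>\<close> arises only in the limit of large \<open>m\<close>.\<close>

lemma integral_cutoff_divergence:
  assumes G: "Ck_on 1 U G" "\<And>x. x \<in> U - K \<Longrightarrow> G x = 0"
  shows "set_integrable lborel U (\<lambda>x. cutoff (m * \<rho> x) * divergence G x)"
    and "set_integrable lborel U (\<lambda>x. m * cutoff_deriv (m * \<rho> x) * (grad \<rho> x \<bullet> G x))"
    and "(LINT x:U|lborel. cutoff (m * \<rho> x) * divergence G x)
      = - (LINT x:U|lborel. m * cutoff_deriv (m * \<rho> x) * (grad \<rho> x \<bullet> G x))"
proof -
  let ?A = "\<lambda>x. cutoff (m * \<rho> x) * divergence G x"
  let ?B = "\<lambda>x. m * cutoff_deriv (m * \<rho> x) * (grad \<rho> x \<bullet> G x)"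
  have D: "((\<lambda>s. cutoff (m * s)) has_field_derivative m * cutoff_deriv (m * s)) (at s)" for s
    by (rule DERIV_cong[OF DERIV_chain2[OF DERIV_cutoff DERIV_cmult[OF DERIV_ident]]]) simp
  have C: "Ck_on 1 U (\<lambda>x. cutoff (m * \<rho> x))"
    by (rule Ck_on_1_compose[where T = UNIV, OF D _ \<rho>])
      (auto intro!: continuous_intros continuous_on_compose2[OF continuous_cutoff_deriv[of UNIV]])
  have divG: "divergence G x = 0" if "x \<in> U - K" for x
    by (rule divergence_eq_0_open[of "U - K"])
      (use that U K G(2) in \<open>auto simp: open_Diff compact_imp_closed\<close>)
  note conts = Ck_on_1_continuous_on[OF \<rho>] continuous_on_grad[OF \<rho>] Ck_on_1_continuous_on[OF G(1)]
    Ck_on_1_continuous_on[OF C] continuous_on_divergence[OF G(1)]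
  show A: "set_integrable lborel U ?A"
    by (rule set_integrable_vanishing_outside_compact[OF U K])
      (auto intro!: continuous_intros conts simp: divG)
  show B: "set_integrable lborel U ?B"
    by (rule set_integrable_vanishing_outside_compact[OF U K])
      (auto intro!: continuous_intros conts continuous_on_compose2[OF continuous_cutoff_deriv[of UNIV]] simp: G(2))
  have "0 = (LINT x:U|lborel. divergence (\<lambda>y. cutoff (m * \<rho> y) *\<^sub>R G y) x)"
    by (rule integral_divergence_compact_support(2)[OF U K Ck_on_1_scaleR[OF C G(1)], symmetric])
      (simp add: G(2))
  also have "\<dots> = (LINT x:U|lborel. ?A x + ?B x)"
  proof (rule set_lebesgue_integral_cong)
    show "U \<in> sets lborel" using U by simp
    show "\<forall>x. x \<in> U \<longrightarrow> divergence (\<lambda>y. cutoff (m * \<rho> y) *\<^sub>R G y) x = ?A x + ?B x"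
    proof (intro allI impI)
      fix x assume x: "x \<in> U"
      show "divergence (\<lambda>y. cutoff (m * \<rho> y) *\<^sub>R G y) x = ?A x + ?B x"
        using divergence_scaleR[OF Ck_on_1_differentiable[OF C x] Ck_on_1_differentiable[OF G(1) x]]
          grad_compose[where f = \<rho>, OF D Ck_on_1_differentiable[OF \<rho> x]]
        by simp
    qed
  qed
  also have "\<dots> = (LINT x:U|lborel. ?A x) + (LINT x:U|lborel. ?B x)"
    by (rule set_integral_add(2)[OF A B])
  finally show "(LINT x:U|lborel. ?A x) = - (LINT x:U|lborel. ?B x)" by simp
qed

text \<open>Cut \<open>\<zeta> V\<close> off near the boundary by \<open>cutoff (m * \<rho>)\<close>, \<open>m \<rightarrow> \<infinity>\<close>. The error term contains
  \<open>m * cutoff_deriv (m * \<rho>)\<close>, which blows up, times \<open>grad \<rho> \<bullet> V\<close>, which is uniformly small on the shrinking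
  boundary layer. The layer integral of the former stays bounded, as one sees from the same identity
  with the constant field \<open>e\<close>, transversal to the boundary, in place of \<open>V\<close>.\<close>

lemma integral_divergence_near_boundary:
  assumes \<zeta>: "Ck_on 1 U \<zeta>" "\<And>x. x \<in> U \<Longrightarrow> 0 \<le> \<zeta> x" "\<And>x. x \<in> U - K \<Longrightarrow> \<zeta> x = 0"
    and V: "Ck_on 1 U V" "\<And>x. x \<in> K \<Longrightarrow> \<rho> x = 0 \<Longrightarrow> grad \<rho> x \<bullet> V x = 0"
    and e: "c > 0" "\<And>x. x \<in> K \<Longrightarrow> c \<le> grad \<rho> x \<bullet> e"
  shows "(LINT x:{x\<in>U. \<rho> x < 0}|lborel. divergence (\<lambda>y. \<zeta> y *\<^sub>R V y) x) = 0"
proof -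
  define G where "G = (\<lambda>y. \<zeta> y *\<^sub>R V y)"
  define E where "E = (\<lambda>y. \<zeta> y *\<^sub>R e)"
  have G: "Ck_on 1 U G" "\<And>x. x \<in> U - K \<Longrightarrow> G x = 0"
    unfolding G_def by (simp_all only: \<zeta>(3) scaleR_zero_left Ck_on_1_scaleR[OF \<zeta>(1) V(1)])
  have E: "Ck_on 1 U E" "\<And>x. x \<in> U - K \<Longrightarrow> E x = 0"
    unfolding E_def by (simp_all only: \<zeta>(3) scaleR_zero_left Ck_on_1_scaleR[OF \<zeta>(1) Ck_on_1_const])
  define I where "I = (\<lambda>n::nat. LINT x:U|lborel. cutoff (real n * \<rho> x) * divergence G x)"
  define C where "C = (LINT x:U|lborel. \<bar>divergence E x\<bar>)"
  have C0: "C \<ge> 0"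
    unfolding C_def set_lebesgue_integral_def by (rule integral_nonneg_AE) auto
  have intG: "set_integrable lborel U (divergence G)" and intE: "set_integrable lborel U (divergence E)"
    using integral_divergence_compact_support(1)[OF U K G] integral_divergence_compact_support(1)[OF U K E]
    by blast+
  have small: "\<exists>N. \<forall>n\<ge>N. \<bar>I n\<bar> \<le> \<delta> / c * C" if "\<delta> > 0" for \<delta>
  proof -
    \<comment> \<open>The bad set, where \<open>V\<close> is not yet nearly tangential. By
      hypothesis \<open>\<rho>\<close> has no zero on it, so compactness keeps
      \<open>\<bar>\<rho>\<bar>\<close> above some \<open>\<tau>\<close> there, and the layer on
      which the cut-off varies misses it as soon as \<open>n > 1 / \<tau>\<close>.\<close>
    define B where "B = K \<inter> (\<lambda>x. \<bar>grad \<rho> x \<bullet> V x\<bar>) -` {\<delta>..}"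
    have "closed B"
      unfolding B_def
      by (intro continuous_closed_preimage continuous_intros compact_imp_closed K
          continuous_on_subset[OF continuous_on_grad[OF \<rho>] K(2)]
          continuous_on_subset[OF Ck_on_1_continuous_on[OF V(1)] K(2)])
    then have "compact B"
      using compact_Int_closed[OF K(1), of B] by (simp add: B_def Int_absorb1 Int_assoc)
    have "\<exists>\<tau>>0. \<forall>x\<in>B. \<tau> \<le> \<bar>\<rho> x\<bar>"
    proof (cases "B = {}")
      case False
      have "continuous_on B (\<lambda>x. \<bar>\<rho> x\<bar>)"
        by (intro continuous_intros continuous_on_subset[OF Ck_on_1_continuous_on[OF \<rho>]])
          (use K(2) in \<open>auto simp: B_def\<close>)
      then obtain x0 where x0: "x0 \<in> B" "\<forall>x\<in>B. \<bar>\<rho> x0\<bar> \<le> \<bar>\<rho> x\<bar>"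
        using continuous_attains_inf[OF \<open>compact B\<close> False] by blast
      then have "\<rho> x0 \<noteq> 0" using V(2)[of x0] \<open>\<delta> > 0\<close> by (auto simp: B_def)
      then show ?thesis using x0 by (intro exI[of _ "\<bar>\<rho> x0\<bar>"]) auto
    qed (auto intro: exI[of _ 1])
    then obtain \<tau> where \<tau>: "\<tau> > 0" "\<And>x. x \<in> B \<Longrightarrow> \<tau> \<le> \<bar>\<rho> x\<bar>" by auto
    obtain N where N: "1 / \<tau> < real N" using reals_Archimedean2 by blast
    have "\<bar>I n\<bar> \<le> \<delta> / c * C" if "n \<ge> N" for n
    proof -
      \<comment> \<open>The sign makes the weight nonnegative, since the cut-off decreases. It is
        concentrated on the layer where \<open>real n * \<rho> x\<close> lies strictly between -1
        and 0.\<close>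
      define w where "w = (\<lambda>x. - (real n * cutoff_deriv (real n * \<rho> x)))"
      have w0: "0 \<le> w x" for x
        unfolding w_def using cutoff_deriv_nonpos by (simp add: mult_nonneg_nonpos)
      have n: "1 / \<tau> < real n" using N that by linarith
      have key: "\<bar>w x * (grad \<rho> x \<bullet> G x)\<bar> \<le> \<delta> / c * (w x * (grad \<rho> x \<bullet> E x))" if "x \<in> U" for x
      proof (cases "x \<in> K \<and> w x \<noteq> 0")
        case False
        then show ?thesis using that G(2)[of x] E(2)[of x] by auto
      next
        case True
        then have "\<not> (real n * \<rho> x \<le> - 1 \<or> 0 \<le> real n * \<rho> x)"
          using cutoff_deriv_eq_0[of "real n * \<rho> x"] by (auto simp: w_def)
        then have "\<bar>real n * \<rho> x\<bar> < 1" by linarith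
        then have "real n * \<bar>\<rho> x\<bar> < 1" by (simp add: abs_mult)
        also have "1 < real n * \<tau>" using n \<tau>(1) by (simp add: field_simps)
        finally have "\<bar>\<rho> x\<bar> < \<tau>"
          by (simp add: mult_less_cancel_left)
        then have "x \<notin> B" using \<tau>(2)[of x] by auto
        then have 1: "\<bar>grad \<rho> x \<bullet> V x\<bar> \<le> \<delta>" using True by (auto simp: B_def)
        \<comment> \<open>Transversality of \<open>e\<close> lets the constant bound
          \<open>\<delta>\<close> be replaced by a multiple of
          \<open>grad \<rho> x \<bullet> e\<close>, which turns the integrand into the one of the
          comparison field \<open>E\<close>.\<close>
        have 2: "1 \<le> (grad \<rho> x \<bullet> e) / c" using e(2)[of x] e(1) True by simp
        have "\<bar>w x * (grad \<rho> x \<bullet> G x)\<bar> = (w x * \<zeta> x) * \<bar>grad \<rho> x \<bullet> V x\<bar>"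
          using w0[of x] \<zeta>(2)[OF that] by (simp add: G_def abs_mult)
        also have "\<dots> \<le> (w x * \<zeta> x) * (\<delta> * ((grad \<rho> x \<bullet> e) / c))"
          using 1 2 \<open>\<delta> > 0\<close> mult_left_mono[OF 2, of \<delta>] w0[of x] \<zeta>(2)[OF that]
          by (intro mult_left_mono) auto
        also have "\<dots> = \<delta> / c * (w x * (grad \<rho> x \<bullet> E x))"
          by (simp add: E_def)
        finally show ?thesis .
      qed
      have wG: "set_integrable lborel U (\<lambda>x. w x * (grad \<rho> x \<bullet> G x))"
        and wE: "set_integrable lborel U (\<lambda>x. w x * (grad \<rho> x \<bullet> E x))"
        using integral_cutoff_divergence(2)[OF G, of "real n"] integral_cutoff_divergence(2)[OF E, of "real n"]
        by (simp_all add: w_def set_integrable_def)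
      have IG: "I n = (LINT x:U|lborel. w x * (grad \<rho> x \<bullet> G x))"
        unfolding I_def w_def using integral_cutoff_divergence(3)[OF G, of "real n"]
        by (simp add: set_lebesgue_integral_def)
      have IE: "(LINT x:U|lborel. w x * (grad \<rho> x \<bullet> E x))
          = (LINT x:U|lborel. cutoff (real n * \<rho> x) * divergence E x)"
        unfolding w_def using integral_cutoff_divergence(3)[OF E, of "real n"]
        by (simp add: set_lebesgue_integral_def)
      have "\<bar>I n\<bar> \<le> (LINT x:U|lborel. \<bar>w x * (grad \<rho> x \<bullet> G x)\<bar>)"
        unfolding IG using set_integral_norm_bound[OF wG] by simp
      also have "\<dots> \<le> (LINT x:U|lborel. \<delta> / c * (w x * (grad \<rho> x \<bullet> E x)))"
        by (intro set_integral_mono set_integrable_abs wG set_integrable_mult_right wE key)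
      also have "\<dots> = \<delta> / c * (LINT x:U|lborel. cutoff (real n * \<rho> x) * divergence E x)"
        unfolding set_integral_mult_right IE ..
      also have "\<dots> \<le> \<delta> / c * C"
        unfolding C_def
      proof (intro mult_left_mono set_integral_mono integral_cutoff_divergence(1)[OF E] set_integrable_abs intE)
        fix x
        have "cutoff (real n * \<rho> x) * divergence E x \<le> cutoff (real n * \<rho> x) * \<bar>divergence E x\<bar>"
          using cutoff_bounds by (intro mult_left_mono) auto
        also have "\<dots> \<le> \<bar>divergence E x\<bar>"
          using cutoff_bounds by (intro mult_left_le_one_le) auto
        finally show "cutoff (real n * \<rho> x) * divergence E x \<le> \<bar>divergence E x\<bar>" .
      qed (use \<open>\<delta> > 0\<close> e(1) in auto)
      finally show ?thesis .
    qed
    then show ?thesis by blast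
  qed
  have "I \<longlonglongrightarrow> 0"
  proof (rule LIMSEQ_I)
    fix r :: real assume "r > 0"
    \<comment> \<open>Chosen so that \<open>\<delta> / c * C\<close> is \<open>r\<close> times a
      factor below 1; the added 1 also covers \<open>C = 0\<close>.\<close>
    define \<delta> where "\<delta> = r * c / (C + 1)"
    have "\<delta> > 0" using \<open>r > 0\<close> e(1) C0 by (simp add: \<delta>_def)
    then obtain N where N: "\<forall>n\<ge>N. \<bar>I n\<bar> \<le> \<delta> / c * C" using small by blast
    have "\<delta> / c * C = r * (C / (C + 1))" using e(1) by (simp add: \<delta>_def)
    also have "\<dots> < r * 1" using \<open>r > 0\<close> C0 by (intro mult_strict_left_mono) auto
    finally show "\<exists>N. \<forall>n\<ge>N. norm (I n - 0) < r"
      using N by (intro exI[of _ N]) force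
  qed
  moreover have "I \<longlonglongrightarrow> (LINT x:{x\<in>U. \<rho> x < 0}|lborel. divergence G x)"
    unfolding I_def set_lebesgue_integral_def
  proof (rule integral_dominated_convergence[where w = "\<lambda>x. \<bar>indicator U x *\<^sub>R divergence G x\<bar>"])
    have "{x\<in>U. \<rho> x < 0} = U \<inter> \<rho> -` {..<0}" by auto
    then have sets: "open {x\<in>U. \<rho> x < 0}"
      using continuous_open_preimage[OF Ck_on_1_continuous_on[OF \<rho>] U, of "{..<0}"] by simp
    have "set_integrable lborel {x\<in>U. \<rho> x < 0} (divergence G)"
      by (rule set_integrable_subset[OF intG]) (use sets in auto)
    then show "(\<lambda>x. indicator {x\<in>U. \<rho> x < 0} x *\<^sub>R divergence G x) \<in> borel_measurable lborel"
      unfolding set_integrable_def by (rule borel_measurable_integrable)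
    show "(\<lambda>x. indicator U x *\<^sub>R (cutoff (real n * \<rho> x) * divergence G x)) \<in> borel_measurable lborel" for n
      using integral_cutoff_divergence(1)[OF G] unfolding set_integrable_def
      by (rule borel_measurable_integrable)
    show "integrable lborel (\<lambda>x. \<bar>indicator U x *\<^sub>R divergence G x\<bar>)"
      using intG unfolding set_integrable_def by (rule integrable_abs)
    show "AE x in lborel. norm (indicator U x *\<^sub>R (cutoff (real n * \<rho> x) * divergence G x))
        \<le> \<bar>indicator U x *\<^sub>R divergence G x\<bar>" for n
      using cutoff_bounds by (intro AE_I2) (auto simp: indicator_def abs_mult intro!: mult_left_le_one_le)
    show "AE x in lborel. (\<lambda>n. indicator U x *\<^sub>R (cutoff (real n * \<rho> x) * divergence G x))
        \<longlonglongrightarrow> indicator {x\<in>U. \<rho> x < 0} x *\<^sub>R divergence G x"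
    proof (rule AE_I2)
      fix x
      \<comment> \<open>Since \<open>cutoff\<close> already vanishes at 0, the limit is the
        indicator of the strict sublevel set at every point, also where
        \<open>\<rho> x = 0\<close>.\<close>
      have "(\<lambda>n. cutoff (real n * \<rho> x)) \<longlonglongrightarrow> indicator {..<0} (\<rho> x)"
      proof (cases "\<rho> x < 0")
        case True
        obtain N where N: "- 1 / \<rho> x < real N" using reals_Archimedean2 by blast
        have "eventually (\<lambda>n. cutoff (real n * \<rho> x) = 1) sequentially"
          unfolding eventually_sequentially
        proof (intro exI[of _ N] allI impI cutoff_eq_1)
          fix n assume "N \<le> n"
          then have "- 1 / \<rho> x < real n" using N by linarith
          then show "real n * \<rho> x \<le> - 1" using True by (simp add: field_simps)
        qed
        then show ?thesis using True by (simp add: tendsto_eventually)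
      next
        case False
        then show ?thesis by (simp add: cutoff_eq_0)
      qed
      then have "(\<lambda>n. indicator U x * (cutoff (real n * \<rho> x) * divergence G x))
          \<longlonglongrightarrow> indicator U x * (indicator {..<0} (\<rho> x) * divergence G x)"
        by (intro tendsto_intros)
      then show "(\<lambda>n. indicator U x *\<^sub>R (cutoff (real n * \<rho> x) * divergence G x))
          \<longlonglongrightarrow> indicator {x\<in>U. \<rho> x < 0} x *\<^sub>R divergence G x"
        by (auto simp: indicator_def split: if_splits)
    qed
  qed
  ultimately show ?thesis
    unfolding G_def using LIMSEQ_unique by blast
qed

end

section \<open>Defining functions and the normal direction\<close>

lemma eventually_less_0_along_ray:
  fixes f :: "'a::euclidean_space \<Rightarrow> real"
  assumes "f differentiable (at x)" "f x = 0" "grad f x \<bullet> v < 0"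
  shows "\<forall>\<^sub>F t in at_right 0. f (x + t *\<^sub>R v) < 0"
proof -
  have "((\<lambda>t. f (x + t *\<^sub>R v)) has_derivative (\<lambda>t. frechet_derivative f (at x) (t *\<^sub>R v))) (at 0)"
    by (rule has_derivative_compose[where f = "\<lambda>t. x + t *\<^sub>R v"])
      (use assms(1) in \<open>auto intro!: derivative_eq_intros simp: frechet_derivative_works[symmetric]\<close>)
  moreover have "frechet_derivative f (at x) (t *\<^sub>R v) = (grad f x \<bullet> v) * t" for t
    using linear_cmul[OF linear_frechet_derivative[OF assms(1)]] by (simp add: inner_grad[OF assms(1)])
  ultimately have "((\<lambda>t. f (x + t *\<^sub>R v)) has_real_derivative grad f x \<bullet> v) (at 0)"
    by (simp add: has_field_derivative_def)
  from DERIV_neg_dec_right[OF this assms(3)] obtain d where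
    "d > 0" "\<forall>h>0. h < d \<longrightarrow> f (x + h *\<^sub>R v) < 0"
    using assms(2) by auto
  then show ?thesis
    unfolding eventually_at_right_field by (intro exI[of _ d]) auto
qed

text \<open>With a positive slope the previous lemma, applied to \<open>f x - f y\<close> as a
  function of \<open>y\<close>, would make \<open>f\<close> exceed its nonnegative value at
  \<open>x\<close> along the ray.\<close>

lemma inner_grad_nonpos_if_eventually:
  fixes f :: "'a::euclidean_space \<Rightarrow> real"
  assumes "f differentiable (at x)" "0 \<le> f x" "\<forall>\<^sub>F t in at_right 0. f (x + t *\<^sub>R v) < 0"
  shows "grad f x \<bullet> v \<le> 0"
proof (rule ccontr)
  assume neg: "\<not> grad f x \<bullet> v \<le> 0"
  define g where "g = (\<lambda>y. f x - f y)"
  have g: "(g has_derivative (\<lambda>v. 0 - frechet_derivative f (at x) v)) (at x)"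
    unfolding g_def using assms(1)
    by (intro has_derivative_diff has_derivative_const) (simp add: frechet_derivative_works)
  have dg: "g differentiable (at x)"
    using g by (auto simp: differentiable_def)
  have "grad g x \<bullet> v = - (grad f x \<bullet> v)"
    unfolding inner_grad[OF dg] inner_grad[OF assms(1)] frechet_derivative_at[OF g, symmetric] by simp
  then have "\<forall>\<^sub>F t in at_right 0. g (x + t *\<^sub>R v) < 0"
    using neg by (intro eventually_less_0_along_ray dg) (auto simp: g_def)
  with assms(3) have "\<forall>\<^sub>F t in at_right (0::real). False"
    by eventually_elim (use assms(2) in \<open>simp add: g_def\<close>)
  then show False by simp
qed

lemma eventually_ray_in_open:
  fixes x :: "'a::real_normed_vector"
  assumes "open U" "x \<in> U"
  shows "\<forall>\<^sub>F t in at_right 0. x + t *\<^sub>R v \<in> U"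
proof -
  have "((\<lambda>t. x + t *\<^sub>R v) \<longlongrightarrow> x + 0 *\<^sub>R v) (at_right 0)"
    by (intro tendsto_intros)
  then show ?thesis
    using topological_tendstoD[of _ _ _ U] assms by simp
qed

lemma C1_defining_functionD:
  assumes "C1_defining_function \<Omega> U \<rho>"
  shows "open U" "Ck_on 1 U \<rho>" "x \<in> U \<Longrightarrow> grad \<rho> x \<noteq> 0" "x \<in> U \<Longrightarrow> x \<in> \<Omega> \<longleftrightarrow> \<rho> x < 0"
  using assms unfolding C1_defining_function_def by blast+

text \<open>Moving from \<open>x\<close> against the nonzero gradient enters \<open>\<Omega>\<close>
  at once, so \<open>x\<close> is a limit of points of \<open>\<Omega>\<close> without belonging to
  it. This links the boundary conditions, posed on \<open>frontier \<Omega>\<close>, to the zero set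
  of \<open>\<rho>\<close>, which is what the local argument sees.\<close>

lemma defining_function_zero_in_frontier:
  assumes \<rho>: "C1_defining_function \<Omega> U \<rho>" and x: "x \<in> U" "\<rho> x = 0"
  shows "x \<in> frontier \<Omega>"
proof -
  note D = C1_defining_functionD[OF \<rho>]
  have "grad \<rho> x \<bullet> (- grad \<rho> x) < 0"
    using D(3)[OF x(1)] by simp
  from eventually_less_0_along_ray[OF Ck_on_1_differentiable[OF D(2) x(1)] x(2) this]
    eventually_ray_in_open[OF D(1) x(1)]
  have "\<forall>\<^sub>F t in at_right 0. x + t *\<^sub>R (- grad \<rho> x) \<in> \<Omega>"
    by eventually_elim (use D(4) in blast)
  then have "\<forall>\<^sub>F t in at_right 0. x + t *\<^sub>R (- grad \<rho> x) \<in> closure \<Omega>"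
    by (rule eventually_mono) (use closure_subset in blast)
  moreover have "((\<lambda>t. x + t *\<^sub>R (- grad \<rho> x)) \<longlongrightarrow> x + 0 *\<^sub>R (- grad \<rho> x)) (at_right 0)"
    by (intro tendsto_intros)
  ultimately have "x \<in> closure \<Omega>"
    using Lim_in_closed_set[of "closure \<Omega>" "\<lambda>t. x + t *\<^sub>R (- grad \<rho> x)" "at_right 0" x] by simp
  moreover have "x \<notin> \<Omega>" using D(4)[OF x(1)] x(2) by simp
  ultimately show ?thesis
    using interior_subset by (auto simp: frontier_def)
qed

text \<open>The normal \<open>\<nu>\<close> may come from a different defining function than the one at hand; two such
  functions have parallel gradients since a vector entering \<open>\<Omega>\<close> for one cannot leave it for the other.\<close>

lemma inner_normal_eq_0_imp_inner_grad_eq_0: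
  assumes \<nu>: "C1_boundary_normal \<Omega> \<nu>" and \<rho>: "C1_defining_function \<Omega> U \<rho>"
    and x: "x \<in> U" "\<rho> x = 0" and w: "w \<bullet> \<nu> x = 0"
  shows "grad \<rho> x \<bullet> w = 0"
proof (rule ccontr)
  assume neq: "grad \<rho> x \<bullet> w \<noteq> 0"
  obtain U' \<rho>' where x': "x \<in> U'" and \<rho>': "C1_defining_function \<Omega> U' \<rho>'"
    and \<nu>x: "\<nu> x = grad \<rho>' x /\<^sub>R norm (grad \<rho>' x)"
    using \<nu> defining_function_zero_in_frontier[OF \<rho> x] unfolding C1_boundary_normal_def by blast
  note D = C1_defining_functionD[OF \<rho>] and D' = C1_defining_functionD[OF \<rho>']
  let ?g = "grad \<rho> x" and ?g' = "grad \<rho>' x"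
  have g': "?g' \<noteq> 0" using D'(3)[OF x'] .
  have w0: "?g' \<bullet> w = 0" using w g' by (simp add: \<nu>x inner_commute)
  define w' where "w' = - sgn (?g \<bullet> w) *\<^sub>R w"
  have "?g \<bullet> w' < 0" "?g' \<bullet> w' = 0"
    using neq w0 by (auto simp: w'_def sgn_if)
  \<comment> \<open>A tilt of \<open>w'\<close> along \<open>?g'\<close>. The size of
    \<open>s\<close> ensures that at most half of the negative slope \<open>?g \<bullet> w'\<close>
    is given back, the added 1 keeping the denominator positive. So \<open>v\<close> still enters
    \<open>\<Omega>\<close> according to \<open>\<rho>\<close>, but it strictly leaves it according
    to \<open>\<rho>'\<close>.\<close>
  moreover define s where "s = - (?g \<bullet> w') / (2 * (\<bar>?g \<bullet> ?g'\<bar> + 1))"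
  define v where "v = w' + s *\<^sub>R ?g'"
  ultimately have "s > 0" by (simp add: s_def divide_neg_pos)
  have "s * (?g \<bullet> ?g') \<le> s * (\<bar>?g \<bullet> ?g'\<bar> + 1)" using \<open>s > 0\<close> by (intro mult_left_mono) auto
  also have "\<dots> = - (?g \<bullet> w') / 2" by (simp add: s_def field_simps)
  finally have "?g \<bullet> v < 0" using \<open>?g \<bullet> w' < 0\<close> by (simp add: v_def inner_add_right)
  from eventually_less_0_along_ray[OF Ck_on_1_differentiable[OF D(2) x(1)] x(2) this]
    eventually_ray_in_open[OF D(1) x(1), of v] eventually_ray_in_open[OF D'(1) x', of v]
  have "\<forall>\<^sub>F t in at_right 0. \<rho>' (x + t *\<^sub>R v) < 0"
    by eventually_elim (use D(4) D'(4) in blast)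
  moreover have "0 \<le> \<rho>' x" using D(4)[OF x(1)] D'(4)[OF x'] x(2) by simp
  ultimately have "?g' \<bullet> v \<le> 0"
    by (intro inner_grad_nonpos_if_eventually Ck_on_1_differentiable[OF D'(2) x'])
  moreover have "?g' \<bullet> v = s * (?g' \<bullet> ?g')" using \<open>?g' \<bullet> w' = 0\<close> by (simp add: v_def inner_add_right)
  moreover have "0 < s * (?g' \<bullet> ?g')" using \<open>s > 0\<close> g' by simp
  ultimately show False by linarith
qed

section \<open>Localization and partition of unity\<close>

lemma set_integral_divergence_vanishing_outside:
  assumes "open \<Omega>" "open T" "closed B" "B \<subseteq> T" "\<And>x. x \<in> \<Omega> - B \<Longrightarrow> V x = 0"
  shows "(LINT x:\<Omega>|lborel. divergence V x) = (LINT x:\<Omega> \<inter> T|lborel. divergence V x)"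
proof -
  have "divergence V x = 0" if "x \<in> \<Omega> - T" for x
    by (rule divergence_eq_0_open[of "\<Omega> - B"]) (use that assms in \<open>auto simp: open_Diff\<close>)
  then have "indicator \<Omega> x *\<^sub>R divergence V x = indicator (\<Omega> \<inter> T) x *\<^sub>R divergence V x" for x
    by (auto simp: indicator_def)
  then show ?thesis unfolding set_lebesgue_integral_def by (intro Bochner_Integration.integral_cong refl)
qed

text \<open>The radius is fixed before the weight \<open>\<zeta>\<close>, because the partition of
  unity can be built only once the radii are known.\<close>

lemma local_divergence_theorem:
  fixes \<Omega> :: "'a::euclidean_space set"
  assumes \<Omega>: "open \<Omega>" "C1_boundary_normal \<Omega> \<nu>" and U: "open U" "closure \<Omega> \<subseteq> U"
    and V: "Ck_on 1 U V" "\<And>x. x \<in> frontier \<Omega> \<Longrightarrow> V x \<bullet> \<nu> x = 0"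
    and x: "x \<in> closure \<Omega>"
  shows "\<exists>r>0. \<forall>\<zeta>. Ck_on 1 UNIV \<zeta> \<longrightarrow> (\<forall>y. 0 \<le> \<zeta> y) \<longrightarrow> (\<forall>y. y \<notin> cball x r \<longrightarrow> \<zeta> y = 0) \<longrightarrow>
    (LINT y:\<Omega>|lborel. divergence (\<lambda>y. \<zeta> y *\<^sub>R V y) y) = 0"
proof (cases "x \<in> \<Omega>")
  case True
  then obtain r where r: "r > 0" "cball x r \<subseteq> \<Omega>"
    using \<Omega>(1) open_contains_cball by blast
  have "Ck_on 1 \<Omega> (\<lambda>y. \<zeta> y *\<^sub>R V y)" if "Ck_on 1 UNIV \<zeta>" for \<zeta>
    using U(2) closure_subset[of \<Omega>]
    by (intro Ck_on_1_scaleR Ck_on_subset[OF that] Ck_on_subset[OF V(1)]) auto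
  then show ?thesis
    by (intro exI[of _ r] conjI allI impI r(1) integral_divergence_compact_support(2)[OF \<Omega>(1) compact_cball r(2)]) auto
next
  case False
  then have "x \<in> frontier \<Omega>" using x \<Omega>(1) by (simp add: frontier_def interior_open)
  then obtain T \<rho> where xT: "x \<in> T" and \<rho>: "C1_defining_function \<Omega> T \<rho>"
    using \<Omega>(2) unfolding C1_boundary_normal_def by blast
  note D = C1_defining_functionD[OF \<rho>]
  define e where "e = grad \<rho> x"
  \<comment> \<open>Half of the value that \<open>grad \<rho> y \<bullet> e\<close> takes at
    \<open>y = x\<close>, so by continuity it stays a lower bound on a small ball. The gradient at
    the centre thus serves as the transversal direction on the whole ball.\<close>
  define c where "c = (e \<bullet> e) / 2"
  have "e \<noteq> 0" unfolding e_def by (rule D(3)[OF xT])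
  then have "c > 0" "c < e \<bullet> e" by (simp_all add: c_def)
  have "open (T \<inter> (\<lambda>y. grad \<rho> y \<bullet> e) -` {c<..})"
    by (intro continuous_open_preimage continuous_intros continuous_on_grad D(1,2))
  then have "open ((T \<inter> (\<lambda>y. grad \<rho> y \<bullet> e) -` {c<..}) \<inter> U)" using U(1) by blast
  moreover have "x \<in> (T \<inter> (\<lambda>y. grad \<rho> y \<bullet> e) -` {c<..}) \<inter> U"
    using xT x U(2) \<open>c < e \<bullet> e\<close> by (auto simp: e_def)
  ultimately obtain r where r: "r > 0" "cball x r \<subseteq> (T \<inter> (\<lambda>y. grad \<rho> y \<bullet> e) -` {c<..}) \<inter> U"
    using open_contains_cball by metis
  show ?thesis
  proof (intro exI[of _ r] conjI allI impI r(1))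
    fix \<zeta> :: "'a \<Rightarrow> real"
    assume \<zeta>: "Ck_on 1 UNIV \<zeta>" "\<forall>y. 0 \<le> \<zeta> y" "\<forall>y. y \<notin> cball x r \<longrightarrow> \<zeta> y = 0"
    have "(LINT y:\<Omega>|lborel. divergence (\<lambda>y. \<zeta> y *\<^sub>R V y) y)
      = (LINT y:\<Omega> \<inter> (T \<inter> U)|lborel. divergence (\<lambda>y. \<zeta> y *\<^sub>R V y) y)"
      by (rule set_integral_divergence_vanishing_outside[OF \<Omega>(1) open_Int[OF D(1) U(1)] closed_cball])
        (use r \<zeta>(3) in auto)
    also have "\<Omega> \<inter> (T \<inter> U) = {y \<in> T \<inter> U. \<rho> y < 0}"
      using D(4) by auto
    also have "(LINT y:\<dots>|lborel. divergence (\<lambda>y. \<zeta> y *\<^sub>R V y) y) = 0"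
    proof (rule integral_divergence_near_boundary[where K = "cball x r" and e = e and c = c])
      show "grad \<rho> y \<bullet> V y = 0" if "y \<in> cball x r" "\<rho> y = 0" for y
      proof -
        have "y \<in> T" using that r(2) by auto
        then show ?thesis
          using inner_normal_eq_0_imp_inner_grad_eq_0[OF \<Omega>(2) \<rho> _ that(2)]
            V(2)[OF defining_function_zero_in_frontier[OF \<rho> _ that(2)]] by blast
      qed
      show "c \<le> grad \<rho> y \<bullet> e" if "y \<in> cball x r" for y
        using that r(2) by fastforce
    qed (use r \<zeta> D U V \<open>c > 0\<close> in \<open>auto simp del: Ck_on.simps intro: Ck_on_subset\<close>)
    finally show "(LINT y:\<Omega>|lborel. divergence (\<lambda>y. \<zeta> y *\<^sub>R V y) y) = 0" .
  qed
qed

lemma set_integrable_continuous_on_closure: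
  fixes f :: "'a::euclidean_space \<Rightarrow> real"
  assumes "open \<Omega>" "bounded \<Omega>" "continuous_on (closure \<Omega>) f"
  shows "set_integrable lborel \<Omega> f"
proof (rule set_integrable_subset)
  show "set_integrable lborel (closure \<Omega>) f"
    unfolding set_integrable_def using assms by (intro borel_integrable_compact) auto
qed (use assms in \<open>auto simp: closure_subset\<close>)

theorem divergence_theorem_tangential:
  fixes \<Omega> :: "'a::euclidean_space set"
  assumes \<Omega>: "open \<Omega>" "bounded \<Omega>" "C1_boundary_normal \<Omega> \<nu>"
    and V: "Ck_closure 1 \<Omega> V" "\<And>x. x \<in> frontier \<Omega> \<Longrightarrow> V x \<bullet> \<nu> x = 0"
  shows "set_integrable lborel \<Omega> (divergence V)" "(LINT x:\<Omega>|lborel. divergence V x) = 0"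
proof -
  obtain U where U: "open U" "closure \<Omega> \<subseteq> U" and VU: "Ck_on 1 U V"
    using V(1) unfolding Ck_closure_def by blast
  have \<Omega>U: "\<Omega> \<subseteq> U" using U(2) closure_subset by blast
  show "set_integrable lborel \<Omega> (divergence V)"
    by (rule set_integrable_continuous_on_closure[OF \<Omega>(1,2) continuous_on_subset[OF continuous_on_divergence[OF VU] U(2)]])
  let ?P = "\<lambda>x r. r > 0 \<and> (\<forall>\<zeta>. Ck_on 1 UNIV \<zeta> \<longrightarrow> (\<forall>y. 0 \<le> \<zeta> y) \<longrightarrow>
    (\<forall>y. y \<notin> cball x r \<longrightarrow> \<zeta> y = 0) \<longrightarrow> (LINT y:\<Omega>|lborel. divergence (\<lambda>y. \<zeta> y *\<^sub>R V y) y) = 0)"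
  have "\<forall>x\<in>closure \<Omega>. \<exists>r. ?P x r"
    using local_divergence_theorem[OF \<Omega>(1,3) U VU V(2)] by blast
  from bchoice[OF this] obtain r where rP: "\<forall>x\<in>closure \<Omega>. ?P x (r x)" ..
  then have r: "\<And>x. x \<in> closure \<Omega> \<Longrightarrow> r x > 0"
    by blast
  have int0: "(LINT y:\<Omega>|lborel. divergence (\<lambda>y. \<zeta> y *\<^sub>R V y) y) = 0"
    if "x \<in> closure \<Omega>" "Ck_on 1 UNIV \<zeta>" "\<And>y. 0 \<le> \<zeta> y" "\<And>y. y \<notin> cball x (r x) \<Longrightarrow> \<zeta> y = 0" for x \<zeta>
    using rP[rule_format, OF that(1)] that(2-) by blast
  have "compact (closure \<Omega>)" using \<Omega>(2) by simp
  then obtain X where X: "X \<subseteq> closure \<Omega>" "finite X" "closure \<Omega> \<subseteq> (\<Union>x\<in>X. ball x (r x))"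
  proof (rule compactE_image[where f = "\<lambda>x. ball x (r x)" and C = "closure \<Omega>"])
    show "closure \<Omega> \<subseteq> (\<Union>x\<in>closure \<Omega>. ball x (r x))"
      using r centre_in_ball by blast
  qed auto
  \<comment> \<open>The squared radius and distance keep the bump differentiable at its centre,
    where the norm is not. It is positive exactly on the open ball.\<close>
  define b where "b = (\<lambda>x y. pos_sq ((r x)\<^sup>2 - (norm (y - x))\<^sup>2))"
  define B where "B = (\<lambda>y. \<Sum>x\<in>X. b x y)"
  have b: "Ck_on 1 T (b x)" for T x
    unfolding b_def by (intro Ck_on_1_pos_sq Ck_on_1_diff Ck_on_1_const Ck_on_1_norm_power2)
  have B: "Ck_on 1 T B" for T
    unfolding B_def by (intro Ck_on_1_sum b)
  have b0: "0 \<le> b x y" for x y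
    by (simp add: b_def pos_sq_nonneg)
  have B0: "0 \<le> B y" for y
    unfolding B_def by (simp add: sum_nonneg b0)
  have Bpos: "0 < B y" if y: "y \<in> closure \<Omega>" for y
  proof -
    obtain x where x: "x \<in> X" "dist x y < r x" using X(3) y by auto
    then have "(norm (y - x))\<^sup>2 < (r x)\<^sup>2"
      by (intro power_strict_mono) (auto simp: dist_norm norm_minus_commute)
    then have "0 < b x y" by (simp add: b_def pos_sq_pos)
    also have "b x y \<le> B y"
      unfolding B_def using X(2) x(1) b0 by (intro member_le_sum) auto
    finally show ?thesis .
  qed
  have "\<exists>\<beta>>0. \<forall>y\<in>closure \<Omega>. \<beta> \<le> B y"
  proof (cases "closure \<Omega> = {}")
    case False
    then obtain y where "y \<in> closure \<Omega>" "\<forall>z\<in>closure \<Omega>. B y \<le> B z"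
      using continuous_attains_inf[OF \<open>compact (closure \<Omega>)\<close> False Ck_on_1_continuous_on[OF B]] by blast
    then show ?thesis using Bpos by blast
  qed (auto intro: exI[of _ 1])
  then obtain \<beta> where \<beta>: "\<beta> > 0" "\<And>y. y \<in> closure \<Omega> \<Longrightarrow> \<beta> \<le> B y" by blast
  \<comment> \<open>\<open>B\<close> made positive everywhere, unchanged on \<open>closure \<Omega>\<close>, so that the partition of unity is globally \<open>C\<^sup>1\<close>\<close>
  define B' where "B' = (\<lambda>y. B y + pos_sq (\<beta> - B y))"
  have B'pos: "0 < B' y" for y
    using B0[of y] \<beta>(1) pos_sq_pos[of "\<beta> - B y"] pos_sq_nonneg[of "\<beta> - B y"]
    unfolding B'_def by (cases "B y = 0") auto
  have B'eq: "B' y = B y" if "y \<in> closure \<Omega>" for y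
    using \<beta>(2)[OF that] by (simp add: B'_def pos_sq_eq_0)
  have B': "Ck_on 1 UNIV B'"
    unfolding B'_def by (intro Ck_on_1_add Ck_on_1_pos_sq Ck_on_1_diff Ck_on_1_const B)
  have invB': "Ck_on 1 UNIV (\<lambda>y. inverse (B' y))"
    by (rule Ck_on_1_compose[where T = "{0<..}" and g' = "\<lambda>s. - (inverse s * inverse s)", OF _ _ B'])
      (use B'pos in \<open>auto intro!: continuous_intros derivative_eq_intros\<close>)
  define \<zeta> where "\<zeta> = (\<lambda>x y. b x y * inverse (B' y))"
  have \<zeta>: "Ck_on 1 UNIV (\<zeta> x)" for x
    unfolding \<zeta>_def by (intro Ck_on_1_mult b invB')
  have \<zeta>sum: "(\<Sum>x\<in>X. \<zeta> x y) = 1" if "y \<in> closure \<Omega>" for y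
    using Bpos[OF that] by (simp add: \<zeta>_def B'eq[OF that] B_def flip: sum_distrib_right)
  have \<zeta>V: "Ck_on 1 U (\<lambda>y. \<zeta> x y *\<^sub>R V y)" for x
    by (intro Ck_on_1_scaleR VU Ck_on_subset[OF \<zeta>]) simp
  have int\<zeta>: "(LINT y:\<Omega>|lborel. divergence (\<lambda>y. \<zeta> x y *\<^sub>R V y) y) = 0" if x: "x \<in> X" for x
  proof (rule int0[OF _ \<zeta>])
    show "x \<in> closure \<Omega>" using x X(1) by blast
    show "0 \<le> \<zeta> x y" for y
      using b0[of x y] B'pos[of y] by (simp add: \<zeta>_def)
    show "\<zeta> x y = 0" if "y \<notin> cball x (r x)" for y
    proof -
      have "r x < norm (y - x)" using that by (simp add: dist_norm norm_minus_commute)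
      then have "(r x)\<^sup>2 \<le> (norm (y - x))\<^sup>2"
        using r[of x] X(1) x by (intro power_mono) auto
      then show ?thesis by (simp add: \<zeta>_def b_def pos_sq_eq_0)
    qed
  qed
  have "(LINT y:\<Omega>|lborel. divergence V y) = (LINT y:\<Omega>|lborel. \<Sum>x\<in>X. divergence (\<lambda>y. \<zeta> x y *\<^sub>R V y) y)"
  proof (rule set_lebesgue_integral_cong)
    show "\<forall>y. y \<in> \<Omega> \<longrightarrow> divergence V y = (\<Sum>x\<in>X. divergence (\<lambda>y. \<zeta> x y *\<^sub>R V y) y)"
    proof (intro allI impI)
      fix y assume y: "y \<in> \<Omega>"
      \<comment> \<open>The weights sum to 1 only on the closure, which suffices because
        \<open>\<Omega>\<close> is an open neighbourhood of \<open>y\<close>.\<close>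
      have "divergence V y = divergence (\<lambda>z. \<Sum>x\<in>X. \<zeta> x z *\<^sub>R V z) y"
        by (rule divergence_cong_open[OF \<Omega>(1) y])
          (simp add: \<zeta>sum closure_subset[THEN subsetD] flip: scaleR_sum_left)
      also have "\<dots> = (\<Sum>x\<in>X. divergence (\<lambda>y. \<zeta> x y *\<^sub>R V y) y)"
        by (rule divergence_sum) (use y \<Omega>U in \<open>auto intro!: Ck_on_1_differentiable[OF \<zeta>V]\<close>)
      finally show "divergence V y = (\<Sum>x\<in>X. divergence (\<lambda>y. \<zeta> x y *\<^sub>R V y) y)" .
    qed
  qed (use \<Omega>(1) in simp)
  also have "\<dots> = (\<Sum>x\<in>X. LINT y:\<Omega>|lborel. divergence (\<lambda>y. \<zeta> x y *\<^sub>R V y) y)"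
    unfolding set_lebesgue_integral_def scaleR_sum_right
    by (rule Bochner_Integration.integral_sum)
      (rule set_integrable_continuous_on_closure[OF \<Omega>(1,2) continuous_on_subset[OF continuous_on_divergence[OF \<zeta>V] U(2)],
        unfolded set_integrable_def])
  also have "\<dots> = 0" by (simp add: int\<zeta>)
  finally show "(LINT y:\<Omega>|lborel. divergence V y) = 0" .
qed

subsection \<open>Functions regular up to the boundary\<close>

text \<open>Each function brings its own neighbourhood of the closure; the passage to their
  intersection is made here for all binary operations.\<close>

lemma Ck_closure_combine:
  assumes "Ck_closure k \<Omega> f" "Ck_closure l \<Omega> g"
    and "\<And>U. open U \<Longrightarrow> Ck_on k U f \<Longrightarrow> Ck_on l U g \<Longrightarrow> Ck_on m U h"
  shows "Ck_closure m \<Omega> h"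
proof -
  obtain U V where "open U" "closure \<Omega> \<subseteq> U" "Ck_on k U f" "open V" "closure \<Omega> \<subseteq> V" "Ck_on l V g"
    using assms(1,2) unfolding Ck_closure_def by blast
  then show ?thesis
    unfolding Ck_closure_def
    by (intro exI[of _ "U \<inter> V"] conjI open_Int assms(3))
      (blast intro: Ck_on_subset)+
qed

lemma Ck_closure_map:
  assumes "Ck_closure k \<Omega> f" "\<And>U. open U \<Longrightarrow> Ck_on k U f \<Longrightarrow> Ck_on m U h"
  shows "Ck_closure m \<Omega> h"
  by (rule Ck_closure_combine[OF assms(1) assms(1) assms(2)])

lemma Ck_closure_1_const: "Ck_closure 1 \<Omega> (\<lambda>x. c)"
  unfolding Ck_closure_def by (intro exI[of _ UNIV] conjI Ck_on_1_const) auto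

lemma Ck_closure_2_imp_1: "Ck_closure 2 \<Omega> f \<Longrightarrow> Ck_closure 1 \<Omega> f"
  by (erule Ck_closure_map) (rule Ck_on_2D)

lemma Ck_closure_1_grad: "Ck_closure 2 \<Omega> f \<Longrightarrow> Ck_closure 1 \<Omega> (grad f)"
  by (erule Ck_closure_map) (rule Ck_on_1_grad)

lemma Ck_closure_2_inner_const: "Ck_closure 2 \<Omega> f \<Longrightarrow> Ck_closure 2 \<Omega> (\<lambda>x. f x \<bullet> b)"
  by (erule Ck_closure_map) (rule Ck_on_2_inner_const)

lemma Ck_closure_1_scaleR: "Ck_closure 1 \<Omega> f \<Longrightarrow> Ck_closure 1 \<Omega> g \<Longrightarrow> Ck_closure 1 \<Omega> (\<lambda>x. f x *\<^sub>R g x)"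
  by (erule (1) Ck_closure_combine) (rule Ck_on_1_scaleR)

lemma Ck_closure_1_inner: "Ck_closure 1 \<Omega> f \<Longrightarrow> Ck_closure 1 \<Omega> g \<Longrightarrow> Ck_closure 1 \<Omega> (\<lambda>x. f x \<bullet> g x)"
  by (erule (1) Ck_closure_combine) (rule Ck_on_1_inner)

lemma Ck_closure_1_mult:
  "Ck_closure 1 \<Omega> f \<Longrightarrow> Ck_closure 1 \<Omega> g \<Longrightarrow> Ck_closure 1 \<Omega> (\<lambda>x. f x * g x :: real)"
  by (erule (1) Ck_closure_combine) (rule Ck_on_1_mult)

lemma Ck_closure_1_add: "Ck_closure 1 \<Omega> f \<Longrightarrow> Ck_closure 1 \<Omega> g \<Longrightarrow> Ck_closure 1 \<Omega> (\<lambda>x. f x + g x)"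
  by (erule (1) Ck_closure_combine) (rule Ck_on_1_add)

lemma Ck_closure_1_diff: "Ck_closure 1 \<Omega> f \<Longrightarrow> Ck_closure 1 \<Omega> g \<Longrightarrow> Ck_closure 1 \<Omega> (\<lambda>x. f x - g x)"
  by (erule (1) Ck_closure_combine) (rule Ck_on_1_diff)

lemma Ck_closure_1_sum:
  assumes "\<And>i. i \<in> I \<Longrightarrow> Ck_closure 1 \<Omega> (f i)"
  shows "Ck_closure 1 \<Omega> (\<lambda>x. \<Sum>i\<in>I. f i x)"
  using assms
proof (induction I rule: infinite_finite_induct)
  case (insert i I)
  then show ?case by (simp only: sum.insert not_False_eq_True if_True, intro Ck_closure_1_add) auto
qed (simp_all only: sum.infinite sum.empty Ck_closure_1_const not_False_eq_True)

lemma Ck_closure_1_compose: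
  assumes "Ck_on 1 UNIV (g :: real \<Rightarrow> real)" "Ck_closure 1 \<Omega> f"
  shows "Ck_closure 1 \<Omega> (\<lambda>x. g (f x))"
  using assms(2)
  by (rule Ck_closure_map) (rule Ck_on_1_compose[OF Ck_on_1_real(1)[OF assms(1)] Ck_on_1_real(2)[OF assms(1), of UNIV]]; simp)

lemmas Ck_closure_1_intros = Ck_closure_1_const Ck_closure_1_scaleR Ck_closure_1_inner Ck_closure_1_mult
  Ck_closure_1_add Ck_closure_1_diff Ck_closure_1_sum

lemma Ck_closure_1_continuous_on: "Ck_closure 1 \<Omega> f \<Longrightarrow> continuous_on (closure \<Omega>) f"
  unfolding Ck_closure_def by (blast intro: continuous_on_subset Ck_on_1_continuous_on)

lemma Ck_closure_1_continuous_on_grad: "Ck_closure 1 \<Omega> f \<Longrightarrow> continuous_on (closure \<Omega>) (grad f)"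
  unfolding Ck_closure_def by (blast intro: continuous_on_subset continuous_on_grad)

lemma Ck_closure_1_differentiable: "Ck_closure 1 \<Omega> f \<Longrightarrow> x \<in> \<Omega> \<Longrightarrow> f differentiable (at x)"
  unfolding Ck_closure_def using closure_subset Ck_on_1_differentiable by blast

lemma grad_inner_self:
  assumes "V differentiable (at x)"
  shows "grad (\<lambda>y. V y \<bullet> V y) x \<bullet> w = 2 * (frechet_derivative V (at x) w \<bullet> V x)"
proof -
  have "((\<lambda>y. V y \<bullet> V y) has_derivative
      (\<lambda>w. V x \<bullet> frechet_derivative V (at x) w + frechet_derivative V (at x) w \<bullet> V x)) (at x)"
    by (intro has_derivative_inner frechet_derivative_works[THEN iffD1] assms)
  note * = this frechet_derivative_at[OF this]
  show ?thesis
    using *(1) unfolding inner_grad[OF differentiableI[OF *(1)]] *(2)[symmetric] by (simp add: inner_commute)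
qed

lemma grad_diff:
  assumes "f differentiable (at x)" "g differentiable (at x)"
  shows "grad (\<lambda>y. f y - g y) x = grad f x - grad g x"
proof -
  have "((\<lambda>y. f y - g y) has_derivative
      (\<lambda>v. frechet_derivative f (at x) v - frechet_derivative g (at x) v)) (at x)"
    by (intro has_derivative_diff frechet_derivative_works[THEN iffD1] assms)
  from frechet_derivative_at[OF this, symmetric] show ?thesis
    by (simp add: grad_def scaleR_diff_left sum_subtractf)
qed

text \<open>The product rule in each component: integration by parts before integrating. The
  subtracted sum is the viscous dissipation density.\<close>

lemma vec_laplacian_inner:
  assumes "Ck_closure 2 \<Omega> v" "x \<in> \<Omega>"
  shows "vec_laplacian v x \<bullet> v x
    = divergence (\<lambda>y. \<Sum>b\<in>Basis. (v y \<bullet> b) *\<^sub>R grad (\<lambda>z. v z \<bullet> b) y) x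
      - (\<Sum>b\<in>Basis. (norm (grad (\<lambda>z. v z \<bullet> b) x))\<^sup>2)"
proof -
  have C: "Ck_closure 1 \<Omega> (\<lambda>z. v z \<bullet> b)" "Ck_closure 1 \<Omega> (grad (\<lambda>z. v z \<bullet> b))" for b
    by (intro Ck_closure_2_imp_1 Ck_closure_1_grad Ck_closure_2_inner_const assms(1))+
  note d = C[THEN Ck_closure_1_differentiable, OF assms(2)]
  have "divergence (\<lambda>y. \<Sum>b\<in>Basis. (v y \<bullet> b) *\<^sub>R grad (\<lambda>z. v z \<bullet> b) y) x
    = (\<Sum>b\<in>Basis. divergence (\<lambda>y. (v y \<bullet> b) *\<^sub>R grad (\<lambda>z. v z \<bullet> b) y) x)"
    by (intro divergence_sum differentiable_scaleR d)
  also have "\<dots> = (\<Sum>b\<in>Basis. (v x \<bullet> b) * divergence (grad (\<lambda>z. v z \<bullet> b)) x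
      + (norm (grad (\<lambda>z. v z \<bullet> b) x))\<^sup>2)"
    by (simp add: divergence_scaleR[OF d] power2_norm_eq_inner)
  finally show ?thesis
    by (simp add: vec_laplacian_def inner_sum_left sum.distrib inner_commute[of "v x"] mult.commute)
qed

lemma set_integrable_continuous_bounded:
  fixes f :: "'a::euclidean_space \<Rightarrow> real"
  assumes "open \<Omega>" "bounded \<Omega>" "continuous_on \<Omega> f" "\<And>x. x \<in> \<Omega> \<Longrightarrow> \<bar>f x\<bar> \<le> B"
  shows "set_integrable lborel \<Omega> f"
proof (rule set_integrable_bound)
  show "set_integrable lborel \<Omega> (\<lambda>_. B)"
    using assms(1,2) by (intro set_integrable_continuous_on_closure continuous_on_const)
  show "set_borel_measurable lborel \<Omega> f"
    unfolding set_borel_measurable_def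
    using borel_measurable_continuous_on_indicator[OF _ assms(3)] assms(1) by simp
qed (use assms(4) in force)

section \<open>Scalar inequalities for the energy terms\<close>

text \<open>Both follow from \<open>ln s \<le> s - 1\<close>, used at \<open>1 / s\<close> and at
  \<open>s\<close>. They make the entropy integrable although \<open>s\<close> may tend to 0 at the
  boundary.\<close>

lemma entropy_bounds:
  assumes "(0::real) < s"
  shows "- 1 \<le> s * (ln s - 1)" "s * (ln s - 1) \<le> s\<^sup>2"
proof -
  have "ln (1 / s) \<le> 1 / s - 1" using assms by (intro ln_le_minus_one) simp
  then have "1 - 1 / s - 1 \<le> ln s - 1" using assms by (simp add: ln_div)
  from mult_left_mono[OF this, of s] show "- 1 \<le> s * (ln s - 1)" using assms by simp
  have "ln s - 1 \<le> s" using ln_le_minus_one[OF assms] by simp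
  from mult_left_mono[OF this, of s] show "s * (ln s - 1) \<le> s\<^sup>2"
    using assms by (simp add: power2_eq_square)
qed

text \<open>The tangent inequality for a convex function with derivative \<open>ln\<close>. The
  tangent is taken at the new value \<open>t\<close> because the logarithms in the scheme are
  implicit.\<close>

lemma entropy_convex:
  assumes "(0::real) < s" "0 < t"
  shows "t * (ln t - 1) - s * (ln s - 1) \<le> (t - s) * ln t"
proof -
  have "ln t - ln s \<le> (t - s) / s" using assms by (intro ln_diff_le)
  then have "s * (ln t - ln s) \<le> t - s" using assms by (simp add: pos_le_divide_eq mult.commute)
  then show ?thesis by (simp add: algebra_simps)
qed

lemma set_integrable_entropy:
  fixes c :: "'a::euclidean_space \<Rightarrow> real"
  assumes "open \<Omega>" "bounded \<Omega>" "Ck_closure 1 \<Omega> c" "\<And>x. x \<in> \<Omega> \<Longrightarrow> 0 < c x + 1"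
  shows "set_integrable lborel \<Omega> (\<lambda>x. (c x + 1) * (ln (c x + 1) - 1))"
proof -
  have cont: "continuous_on (closure \<Omega>) c" by (rule Ck_closure_1_continuous_on[OF assms(3)])
  have "bounded (c ` closure \<Omega>)"
    using assms(2) by (intro compact_imp_bounded compact_continuous_image cont) simp
  then obtain B where B: "\<And>x. x \<in> closure \<Omega> \<Longrightarrow> \<bar>c x\<bar> \<le> B" unfolding bounded_iff by auto
  show ?thesis
  proof (rule set_integrable_continuous_bounded[OF assms(1,2), where B = "max 1 ((B + 1)\<^sup>2)"])
    show "continuous_on \<Omega> (\<lambda>x. (c x + 1) * (ln (c x + 1) - 1))"
      using assms(4) by (intro continuous_intros continuous_on_subset[OF cont closure_subset]) force
    fix x assume x: "x \<in> \<Omega>"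
    have "(c x + 1)\<^sup>2 \<le> (B + 1)\<^sup>2"
      using B[of x] assms(4)[OF x] closure_subset x by (intro power_mono) force+
    then show "\<bar>(c x + 1) * (ln (c x + 1) - 1)\<bar> \<le> max 1 ((B + 1)\<^sup>2)"
      using entropy_bounds[OF assms(4)[OF x]] by linarith
  qed
qed

text \<open>The bound on \<open>f''\<close> makes \<open>S * s\<^sup>2 - f s\<close> convex, so it
  lies above its tangent at \<open>a\<close>. The bound is one-sided on purpose: it will also be
  applied to the negative of the quartic well, whose second derivative is unbounded below.\<close>

lemma quadratic_upper_bound:
  fixes f :: "real \<Rightarrow> real"
  assumes "\<And>s. (f has_real_derivative f' s) (at s)" "\<And>s. (f' has_real_derivative f'' s) (at s)"
    and "\<And>s. f'' s \<le> 2 * S"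
  shows "f b \<le> f a + f' a * (b - a) + S * (b - a)\<^sup>2"
proof -
  have d: "((\<lambda>s. S * s\<^sup>2 - f s) has_real_derivative 2 * S * s - f' s) (at s)" for s
    by (auto intro!: derivative_eq_intros assms(1))
  have "convex_on UNIV (\<lambda>s. S * s\<^sup>2 - f s)"
    by (rule f''_ge0_imp_convex[where f' = "\<lambda>s. 2 * S * s - f' s" and f'' = "\<lambda>s. 2 * S - f'' s"])
      (use assms(3) in \<open>auto intro!: derivative_eq_intros assms(1,2)\<close>)
  from convex_on_imp_above_tangent[OF this connected_UNIV _ UNIV_I d, of a b]
  show ?thesis by (simp add: algebra_simps power2_eq_square)
qed

text \<open>The coupling terms contain the untruncated quartic. Its negative has second derivative
  \<open>1 - 3 * s\<^sup>2\<close>, at most 1, and this is the origin of the threshold 1/2.\<close>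

lemma double_well_lower_bound:
  assumes "1 / 2 \<le> (S::real)"
  shows "(a\<^sup>2 - 1)\<^sup>2 / 4 + (a ^ 3 - a) * (b - a) - S * (b - a)\<^sup>2 \<le> (b\<^sup>2 - 1)\<^sup>2 / 4"
proof -
  have "- ((b\<^sup>2 - 1)\<^sup>2 / 4) \<le> - ((a\<^sup>2 - 1)\<^sup>2 / 4) + (- (a ^ 3 - a)) * (b - a) + S * (b - a)\<^sup>2"
  proof (rule quadratic_upper_bound[where f'' = "\<lambda>s. 1 - 3 * s\<^sup>2"])
    show "((\<lambda>s. - ((s\<^sup>2 - 1)\<^sup>2 / 4)) has_real_derivative - (s ^ 3 - s)) (at s)" for s :: real
      by (auto intro!: derivative_eq_intros simp: power2_eq_square power3_eq_cube field_simps)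
    show "((\<lambda>s. - (s ^ 3 - s)) has_real_derivative 1 - 3 * s\<^sup>2) (at s)" for s :: real
      by (auto intro!: derivative_eq_intros)
    show "1 - 3 * s\<^sup>2 \<le> 2 * S" for s :: real
      using assms zero_le_power2[of s] by linarith
  qed
  then show ?thesis unfolding mult_minus_left by linarith
qed

lemma diff_quot_mult: "(t - s) * diff_quot g s t = g t - g s"
  by (simp add: diff_quot_def)

lemma continuous_on_reac: "continuous_on T (reac k)"
proof -
  \<comment> \<open>A single formula for both branches: the positive part of
    \<open>1 - s\<^sup>2\<close> is zero exactly where the reaction rate is switched off.\<close>
  have "reac k s = k * pos_sq (1 - s\<^sup>2)" for s
    using abs_square_le_1[of s] by (auto simp: reac_def pos_sq_def max_def power2_commute abs_le_iff)
  then have "reac k = (\<lambda>s. k * pos_sq (1 - s\<^sup>2))" by blast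
  then show ?thesis by (simp add: pos_sq_def) (intro continuous_intros)
qed

lemma L2_norm_power2:
  "(L2_norm \<Omega> f)\<^sup>2 = (LINT x:\<Omega>|lborel. (norm (f x))\<^sup>2)"
  unfolding L2_norm_def set_lebesgue_integral_def
  by (intro real_sqrt_pow2 integral_nonneg_AE) auto

subsection \<open>One step of the scheme\<close>

text \<open>\<open>F\<close> is the quartic on a neighbourhood of 0, so both derivatives at 0 are
  those of the quartic.\<close>

lemma deriv_double_well_0:
  assumes "Ck_on 2 UNIV F" "0 < M0" "\<And>s. \<bar>s\<bar> \<le> M0 \<Longrightarrow> F s = 1 / 4 * (s\<^sup>2 - 1)\<^sup>2"
  shows "deriv (deriv F) 0 = (- 1 :: real)"
proof -
  have 1: "deriv F s = s ^ 3 - s" if "s \<in> {- M0<..<M0}" for s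
  proof (rule DERIV_imp_deriv)
    have "((\<lambda>s. 1 / 4 * (s\<^sup>2 - 1)\<^sup>2) has_real_derivative s ^ 3 - s) (at s)"
      by (auto intro!: derivative_eq_intros simp: power2_eq_square power3_eq_cube field_simps)
    then show "(F has_real_derivative s ^ 3 - s) (at s)"
      by (rule has_field_derivative_transform_within_open[of _ _ _ "{- M0<..<M0}"])
        (use that assms(3) in auto)
  qed
  show ?thesis
  proof (rule DERIV_imp_deriv)
    have "((\<lambda>s. s ^ 3 - s) has_real_derivative - 1) (at 0)"
      by (auto intro!: derivative_eq_intros)
    then show "(deriv F has_real_derivative - 1) (at 0)"
      by (rule has_field_derivative_transform_within_open[of _ _ _ "{- M0<..<M0}"])
        (use 1 assms(2) in auto)
  qed
qed

lemma Ck_on_2_deriv: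
  assumes "Ck_on 2 UNIV (F :: real \<Rightarrow> real)"
  shows "Ck_on 1 UNIV (deriv F)"
proof -
  have "frechet_derivative F (at s) 1 = deriv F s" for s
    using frechet_derivative_at[OF Ck_on_1_real(1)[OF Ck_on_2D(2)[OF assms], unfolded has_field_derivative_def]]
    by (metis mult_1_right)
  then show ?thesis
    using Ck_on_2D(1)[OF assms, of 1] by presburger
qed

section \<open>Balance laws in flux form and conservation of mass\<close>

text \<open>Diffusive minus advective flux, so that each transport equation reads: increment equals
  \<open>dt\<close> times divergence of the flux, plus reaction. \<open>\<kappa>\<close> is separate
  from \<open>K\<close> because the species equations carry it outside the divergence.\<close>

definition flux :: "real \<Rightarrow> ('a::euclidean_space \<Rightarrow> real) \<Rightarrow> ('a \<Rightarrow> real) \<Rightarrow> ('a \<Rightarrow> real) \<Rightarrow> ('a \<Rightarrow> 'a) \<Rightarrow> 'a \<Rightarrow> 'a" where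
  "flux \<kappa> K \<mu> w v = (\<lambda>y. \<kappa> *\<^sub>R (K y *\<^sub>R grad \<mu> y) - w y *\<^sub>R v y)"

lemma Ck_closure_flux:
  assumes "Ck_closure 1 \<Omega> K" "Ck_closure 2 \<Omega> \<mu>" "Ck_closure 1 \<Omega> w" "Ck_closure 1 \<Omega> v"
  shows "Ck_closure 1 \<Omega> (flux \<kappa> K \<mu> w v)"
  unfolding flux_def by (intro Ck_closure_1_intros Ck_closure_1_grad assms)

lemma divergence_flux:
  assumes "Ck_closure 1 \<Omega> K" "Ck_closure 2 \<Omega> \<mu>" "Ck_closure 1 \<Omega> w" "Ck_closure 1 \<Omega> v" "x \<in> \<Omega>"
  shows "divergence (flux \<kappa> K \<mu> w v) x
    = \<kappa> * divergence (\<lambda>y. K y *\<^sub>R grad \<mu> y) x - divergence (\<lambda>y. w y *\<^sub>R v y) x"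
proof -
  have "Ck_closure 1 \<Omega> (\<lambda>y. K y *\<^sub>R grad \<mu> y)" "Ck_closure 1 \<Omega> (\<lambda>y. w y *\<^sub>R v y)"
    "Ck_closure 1 \<Omega> (\<lambda>y. \<kappa> *\<^sub>R (K y *\<^sub>R grad \<mu> y))"
    by (intro Ck_closure_1_intros Ck_closure_1_grad assms)+
  note d = this[THEN Ck_closure_1_differentiable, OF assms(5)]
  show ?thesis
    unfolding flux_def divergence_diff[OF d(3,2)] divergence_const_scaleR[OF d(1)] ..
qed

text \<open>Testing a transport equation with its potential. The last term, work done by advection,
  is the one that the coupling forces in the momentum equation cancel.\<close>

lemma divergence_scaleR_flux:
  assumes "Ck_closure 1 \<Omega> K" "Ck_closure 2 \<Omega> \<mu>" "Ck_closure 1 \<Omega> w" "Ck_closure 1 \<Omega> v" "x \<in> \<Omega>"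
  shows "\<mu> x * divergence (flux \<kappa> K \<mu> w v) x
    = divergence (\<lambda>y. \<mu> y *\<^sub>R flux \<kappa> K \<mu> w v y) x - \<kappa> * K x * (norm (grad \<mu> x))\<^sup>2 + w x * (grad \<mu> x \<bullet> v x)"
proof -
  have "Ck_closure 1 \<Omega> (flux \<kappa> K \<mu> w v)" "Ck_closure 1 \<Omega> \<mu>"
    by (intro Ck_closure_flux Ck_closure_2_imp_1 assms(1-4))+
  note d = this[THEN Ck_closure_1_differentiable, OF assms(5)]
  show ?thesis
    unfolding divergence_scaleR[OF d(2,1)]
    by (simp add: flux_def inner_diff_right power2_norm_eq_inner)
qed

text \<open>One step in isolation, with primes for the new phase, velocity and concentrations; the
  pressure and the potentials are new, \<open>D1\<close> is old. The old velocity is also assumed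
  solenoidal and zero on the boundary, as it drives the convection.\<close>

locale scheme_step =
  fixes \<Omega> :: "'a::euclidean_space set" and \<nu> :: "'a \<Rightarrow> 'a"
    and Rey Pe eps Mob M N D2 D3 k S a1 a2 a3 dt :: real
    and lam F :: "real \<Rightarrow> real"
    and u u' :: "'a \<Rightarrow> 'a"
    and \<phi> \<phi>' c1 c1' c2 c2' c3 c3' p \<mu>\<phi> \<mu>1 \<mu>2 \<mu>3 D1 :: "'a \<Rightarrow> real"
  assumes domain: "open \<Omega>" "bounded \<Omega>" "C1_boundary_normal \<Omega> \<nu>"
    and constants: "Rey > 0" "Pe > 0" "Mob \<ge> 0" "M \<ge> 0" "N \<ge> 0"
      "D2 > 0" "D3 > 0" "k \<ge> 0" "a1 + a2 = a3" "dt > 0"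
    and lam: "Ck_on 1 UNIV lam" "\<And>s. lam s > 0"
    and F: "Ck_on 2 UNIV F"
    and regular: "Ck_closure 2 \<Omega> u" "Ck_closure 2 \<Omega> u'" "Ck_closure 2 \<Omega> \<phi>" "Ck_closure 2 \<Omega> \<phi>'"
      "Ck_closure 1 \<Omega> c1" "Ck_closure 1 \<Omega> c1'" "Ck_closure 1 \<Omega> c2" "Ck_closure 1 \<Omega> c2'"
      "Ck_closure 1 \<Omega> c3" "Ck_closure 1 \<Omega> c3'" "Ck_closure 1 \<Omega> p" "Ck_closure 2 \<Omega> \<mu>\<phi>"
      "Ck_closure 2 \<Omega> \<mu>1" "Ck_closure 2 \<Omega> \<mu>2" "Ck_closure 2 \<Omega> \<mu>3" "Ck_closure 1 \<Omega> D1"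
    and positive: "\<And>x. x \<in> \<Omega> \<Longrightarrow> c1 x + 1 > 0" "\<And>x. x \<in> \<Omega> \<Longrightarrow> c1' x + 1 > 0"
      "\<And>x. x \<in> \<Omega> \<Longrightarrow> c2 x + 1 > 0" "\<And>x. x \<in> \<Omega> \<Longrightarrow> c2' x + 1 > 0"
      "\<And>x. x \<in> \<Omega> \<Longrightarrow> c3 x + 1 > 0" "\<And>x. x \<in> \<Omega> \<Longrightarrow> c3' x + 1 > 0" "\<And>x. x \<in> \<Omega> \<Longrightarrow> D1 x > 0"
    and incompressible: "\<And>x. x \<in> \<Omega> \<Longrightarrow> divergence u x = 0" "\<And>x. x \<in> \<Omega> \<Longrightarrow> divergence u' x = 0"
    and momentum: "\<And>x. x \<in> \<Omega> \<Longrightarrow>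
      Rey *\<^sub>R ((u' x - u x) /\<^sub>R dt + advect u u' x)
      = vec_laplacian u' x - grad p x - \<phi> x *\<^sub>R grad \<mu>\<phi> x
        - (c1' x *\<^sub>R grad \<mu>1 x + c2' x *\<^sub>R grad \<mu>2 x + c3' x *\<^sub>R grad \<mu>3 x)"
    and phase: "\<And>x. x \<in> \<Omega> \<Longrightarrow>
      (\<phi>' x - \<phi> x) / dt + divergence (\<lambda>y. \<phi> y *\<^sub>R u' y) x = divergence (\<lambda>y. Mob *\<^sub>R grad \<mu>\<phi> y) x"
    and phase_potential: "\<And>x. x \<in> \<Omega> \<Longrightarrow>
      \<mu>\<phi> x =
        - eps\<^sup>2 * divergence (\<lambda>y. lam (c3 y) *\<^sub>R grad \<phi>' y) x
        + lam (c3 x) * deriv F (\<phi> x) + lam (c3 x) * S * (\<phi>' x - \<phi> x)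
        + 2 * \<phi>' x * (M * (c2' x + 1) + M * (c3' x + 1))
        - ((\<phi> x) ^ 3 - \<phi> x) * (N * (c2 x + 1) + N * (c3 x + 1))
        + S * (\<phi>' x - \<phi> x) * (N * (c2 x + 1) + N * (c3 x + 1))"
    and species1: "\<And>x. x \<in> \<Omega> \<Longrightarrow>
      (c1' x - c1 x) / dt + divergence (\<lambda>y. c1' y *\<^sub>R u' y) x
      = 1 / Pe * divergence (\<lambda>y. (D1 y * (c1' y + 1)) *\<^sub>R grad \<mu>1 y) x
        - a1 * reac k (\<phi> x) * (a1 * \<mu>1 x + a2 * \<mu>2 x - a3 * \<mu>3 x)"
    and potential1: "\<And>x. x \<in> \<Omega> \<Longrightarrow> \<mu>1 x = ln (c1' x + 1)"
    and species2: "\<And>x. x \<in> \<Omega> \<Longrightarrow>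
      (c2' x - c2 x) / dt + divergence (\<lambda>y. c2' y *\<^sub>R u' y) x
      = D2 / Pe * divergence (\<lambda>y. (c2' y + 1) *\<^sub>R grad \<mu>2 y) x
        - a2 * reac k (\<phi> x) * (a1 * \<mu>1 x + a2 * \<mu>2 x - a3 * \<mu>3 x)"
    and potential2: "\<And>x. x \<in> \<Omega> \<Longrightarrow>
      \<mu>2 x = ln (c2' x + 1) + M * (\<phi> x)\<^sup>2 - N / 4 * ((\<phi>' x)\<^sup>2 - 1)\<^sup>2"
    and species3: "\<And>x. x \<in> \<Omega> \<Longrightarrow>
      (c3' x - c3 x) / dt + divergence (\<lambda>y. c3' y *\<^sub>R u' y) x
      = D3 / Pe * divergence (\<lambda>y. (c3' y + 1) *\<^sub>R grad \<mu>3 y) x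
        + a3 * reac k (\<phi> x) * (a1 * \<mu>1 x + a2 * \<mu>2 x - a3 * \<mu>3 x)"
    and potential3: "\<And>x. x \<in> \<Omega> \<Longrightarrow>
      \<mu>3 x = diff_quot lam (c3 x) (c3' x) * (F (\<phi>' x) + eps\<^sup>2 / 2 * (norm (grad \<phi>' x))\<^sup>2)
        + ln (c3' x + 1) + M * (\<phi> x)\<^sup>2 - N / 4 * ((\<phi>' x)\<^sup>2 - 1)\<^sup>2"
    and boundary: "\<And>x. x \<in> frontier \<Omega> \<Longrightarrow> u' x = 0" "\<And>x. x \<in> frontier \<Omega> \<Longrightarrow> u x = 0"
      "\<And>x. x \<in> frontier \<Omega> \<Longrightarrow> grad \<phi>' x \<bullet> \<nu> x = 0"
      "\<And>x. x \<in> frontier \<Omega> \<Longrightarrow> grad \<mu>\<phi> x \<bullet> \<nu> x = 0"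
      "\<And>x. x \<in> frontier \<Omega> \<Longrightarrow> grad \<mu>1 x \<bullet> \<nu> x = 0"
      "\<And>x. x \<in> frontier \<Omega> \<Longrightarrow> grad \<mu>2 x \<bullet> \<nu> x = 0"
      "\<And>x. x \<in> frontier \<Omega> \<Longrightarrow> grad \<mu>3 x \<bullet> \<nu> x = 0"
begin

lemmas regular_1 = regular(5-11,16) regular(1-4,12-15)[THEN Ck_closure_2_imp_1]

definition "Qphi = flux 1 (\<lambda>_. Mob) \<mu>\<phi> \<phi> u'"
definition "Q1 = flux (1 / Pe) (\<lambda>y. D1 y * (c1' y + 1)) \<mu>1 c1' u'"
definition "Q2 = flux (D2 / Pe) (\<lambda>y. c2' y + 1) \<mu>2 c2' u'"
definition "Q3 = flux (D3 / Pe) (\<lambda>y. c3' y + 1) \<mu>3 c3' u'"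
definition "affinity x = a1 * \<mu>1 x + a2 * \<mu>2 x - a3 * \<mu>3 x"

lemma Ck_closure_Q: "Ck_closure 1 \<Omega> Qphi" "Ck_closure 1 \<Omega> Q1" "Ck_closure 1 \<Omega> Q2" "Ck_closure 1 \<Omega> Q3"
  unfolding Qphi_def Q1_def Q2_def Q3_def by (intro Ck_closure_flux Ck_closure_1_intros regular regular_1)+

lemma Q_tangential:
  assumes "x \<in> frontier \<Omega>"
  shows "Qphi x \<bullet> \<nu> x = 0" "Q1 x \<bullet> \<nu> x = 0" "Q2 x \<bullet> \<nu> x = 0" "Q3 x \<bullet> \<nu> x = 0"
  unfolding Qphi_def Q1_def Q2_def Q3_def flux_def
  by (simp_all add: boundary[OF assms] inner_diff_left)

lemma balance:
  assumes x: "x \<in> \<Omega>"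
  shows "\<phi>' x - \<phi> x = dt * divergence Qphi x"
    "c1' x - c1 x = dt * (divergence Q1 x - a1 * reac k (\<phi> x) * affinity x)"
    "c2' x - c2 x = dt * (divergence Q2 x - a2 * reac k (\<phi> x) * affinity x)"
    "c3' x - c3 x = dt * (divergence Q3 x + a3 * reac k (\<phi> x) * affinity x)"
proof -
  have dQ: "divergence Qphi x = 1 * divergence (\<lambda>y. Mob *\<^sub>R grad \<mu>\<phi> y) x - divergence (\<lambda>y. \<phi> y *\<^sub>R u' y) x"
    "divergence Q1 x = 1 / Pe * divergence (\<lambda>y. (D1 y * (c1' y + 1)) *\<^sub>R grad \<mu>1 y) x - divergence (\<lambda>y. c1' y *\<^sub>R u' y) x"
    "divergence Q2 x = D2 / Pe * divergence (\<lambda>y. (c2' y + 1) *\<^sub>R grad \<mu>2 y) x - divergence (\<lambda>y. c2' y *\<^sub>R u' y) x"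
    "divergence Q3 x = D3 / Pe * divergence (\<lambda>y. (c3' y + 1) *\<^sub>R grad \<mu>3 y) x - divergence (\<lambda>y. c3' y *\<^sub>R u' y) x"
    unfolding Qphi_def Q1_def Q2_def Q3_def
    by (intro divergence_flux[OF _ _ _ _ x] Ck_closure_1_intros regular regular_1)+
  have scale: "b - a = dt * r" if "(b - a) / dt + d = s" "r = s - d" for a b d r s :: real
  proof -
    have "(b - a) / dt = r" using that by simp
    then show ?thesis using constants by (simp add: field_simps)
  qed
  show "\<phi>' x - \<phi> x = dt * divergence Qphi x"
    by (rule scale[OF phase[OF x]]) (simp add: dQ)
  show "c1' x - c1 x = dt * (divergence Q1 x - a1 * reac k (\<phi> x) * affinity x)"
    by (rule scale[OF species1[OF x]]) (simp add: dQ affinity_def)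
  show "c2' x - c2 x = dt * (divergence Q2 x - a2 * reac k (\<phi> x) * affinity x)"
    by (rule scale[OF species2[OF x]]) (simp add: dQ affinity_def)
  show "c3' x - c3 x = dt * (divergence Q3 x + a3 * reac k (\<phi> x) * affinity x)"
    by (rule scale[OF species3[OF x]]) (simp add: dQ affinity_def)
qed

lemma integral_divergence_eq_0:
  assumes "Ck_closure 1 \<Omega> V" "\<And>x. x \<in> frontier \<Omega> \<Longrightarrow> V x \<bullet> \<nu> x = 0"
  shows "set_integrable lborel \<Omega> (divergence V)" "(LINT x:\<Omega>|lborel. divergence V x) = 0"
  using divergence_theorem_tangential[OF domain assms] by blast+

text \<open>Because \<open>a1 + a2 = a3\<close>, the reaction terms cancel in the sum. What is left
  is the divergence of a tangential field, as the velocity and the normal derivatives of the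
  potentials vanish on the boundary.\<close>

lemma mass_conservation:
  "(LINT x:\<Omega>|lborel. c1' x + c2' x + c3' x) = (LINT x:\<Omega>|lborel. c1 x + c2 x + c3 x)"
proof -
  let ?s' = "\<lambda>x. c1' x + c2' x + c3' x" and ?s = "\<lambda>x. c1 x + c2 x + c3 x"
  define V where "V = (\<lambda>x. dt *\<^sub>R (Q1 x + Q2 x + Q3 x))"
  have V: "Ck_closure 1 \<Omega> V"
    unfolding V_def by (intro Ck_closure_1_intros Ck_closure_Q)
  have int: "set_integrable lborel \<Omega> ?s'" "set_integrable lborel \<Omega> ?s"
    by (intro set_integrable_continuous_on_closure[OF domain(1,2)] Ck_closure_1_continuous_on
        Ck_closure_1_intros regular_1)+
  have "?s' x - ?s x = divergence V x" if x: "x \<in> \<Omega>" for x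
  proof -
    note d = Ck_closure_Q[THEN Ck_closure_1_differentiable, OF x]
    have "divergence V x = dt * (divergence Q1 x + divergence Q2 x + divergence Q3 x)"
      unfolding V_def
      by (simp only: divergence_const_scaleR divergence_add differentiable_add d)
    moreover have "?s' x - ?s x = (c1' x - c1 x) + (c2' x - c2 x) + (c3' x - c3 x)" by simp
    moreover have "a3 = a1 + a2" using constants by simp
    ultimately show ?thesis unfolding balance[OF x] by (simp add: algebra_simps)
  qed
  then have "(LINT x:\<Omega>|lborel. ?s' x - ?s x) = (LINT x:\<Omega>|lborel. divergence V x)"
    by (intro set_lebesgue_integral_cong) (use domain in auto)
  also have "\<dots> = 0"
    by (rule integral_divergence_eq_0(2)[OF V]) (simp add: V_def inner_add_left Q_tangential)
  finally show ?thesis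
    using set_integral_diff(2)[OF int] by simp
qed

end

section \<open>Pointwise energy balance and its integral\<close>

text \<open>The integrands of \<open>energy\<close> under one integral sign, which turns stability
  into a pointwise estimate.\<close>

definition energy_density ::
    "real \<Rightarrow> real \<Rightarrow> (real \<Rightarrow> real) \<Rightarrow> (real \<Rightarrow> real) \<Rightarrow> real \<Rightarrow> real \<Rightarrow> ('a::euclidean_space \<Rightarrow> 'a) \<Rightarrow>
     ('a \<Rightarrow> real) \<Rightarrow> ('a \<Rightarrow> real) \<Rightarrow> ('a \<Rightarrow> real) \<Rightarrow> ('a \<Rightarrow> real) \<Rightarrow> 'a \<Rightarrow> real" where
  "energy_density Rey eps lam F M N u \<phi> c1 c2 c3 x =
     Rey / 2 * (norm (u x))\<^sup>2
   + (eps\<^sup>2 / 2 * lam (c3 x) * (norm (grad \<phi> x))\<^sup>2 + lam (c3 x) * F (\<phi> x))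
   + (c1 x + 1) * (ln (c1 x + 1) - 1)
   + (c2 x + 1) * (ln (c2 x + 1) - 1)
   + (c3 x + 1) * (ln (c3 x + 1) - 1)
   + (\<phi> x)\<^sup>2 * (M * (c2 x + 1) + M * (c3 x + 1))
   - ((\<phi> x)\<^sup>2 - 1)\<^sup>2 / 4 * (N * (c2 x + 1) + N * (c3 x + 1))"

lemma energy_eq_integral:
  assumes \<Omega>: "open \<Omega>" "bounded \<Omega>" and lam: "Ck_on 1 UNIV lam" and F: "Ck_on 2 UNIV F"
    and reg: "Ck_closure 2 \<Omega> u" "Ck_closure 2 \<Omega> \<phi>" "Ck_closure 1 \<Omega> c1" "Ck_closure 1 \<Omega> c2" "Ck_closure 1 \<Omega> c3"
    and pos: "\<And>x. x \<in> \<Omega> \<Longrightarrow> c1 x + 1 > 0" "\<And>x. x \<in> \<Omega> \<Longrightarrow> c2 x + 1 > 0" "\<And>x. x \<in> \<Omega> \<Longrightarrow> c3 x + 1 > 0"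
  shows "set_integrable lborel \<Omega> (energy_density Rey eps lam F M N u \<phi> c1 c2 c3)"
    and "energy \<Omega> Rey eps lam F M N u \<phi> c1 c2 c3
      = (LINT x:\<Omega>|lborel. energy_density Rey eps lam F M N u \<phi> c1 c2 c3 x)"
proof -
  note int = set_integrable_continuous_on_closure[OF \<Omega>]
  note cont = reg(1,2)[THEN Ck_closure_2_imp_1, THEN Ck_closure_1_continuous_on]
    reg(3-5)[THEN Ck_closure_1_continuous_on] Ck_closure_1_continuous_on_grad[OF Ck_closure_2_imp_1[OF reg(2)]]
    Ck_closure_1_continuous_on[OF Ck_closure_1_compose[OF lam reg(5)]]
    Ck_closure_1_continuous_on[OF Ck_closure_1_compose[OF Ck_on_2D(2)[OF F] Ck_closure_2_imp_1[OF reg(2)]]]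
  have 1: "set_integrable lborel \<Omega> (\<lambda>x. Rey / 2 * (norm (u x))\<^sup>2)"
    by (intro int continuous_intros cont)
  have 2: "set_integrable lborel \<Omega> (\<lambda>x. eps\<^sup>2 / 2 * lam (c3 x) * (norm (grad \<phi> x))\<^sup>2 + lam (c3 x) * F (\<phi> x))"
    by (intro int continuous_intros cont)
  have 3: "set_integrable lborel \<Omega> (\<lambda>x. (c1 x + 1) * (ln (c1 x + 1) - 1))"
    "set_integrable lborel \<Omega> (\<lambda>x. (c2 x + 1) * (ln (c2 x + 1) - 1))"
    "set_integrable lborel \<Omega> (\<lambda>x. (c3 x + 1) * (ln (c3 x + 1) - 1))"
    by (intro set_integrable_entropy \<Omega> reg pos; assumption)+
  have 4: "set_integrable lborel \<Omega> (\<lambda>x. (\<phi> x)\<^sup>2 * (M * (c2 x + 1) + M * (c3 x + 1)))"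
    by (intro int continuous_intros cont)
  have 5: "set_integrable lborel \<Omega> (\<lambda>x. ((\<phi> x)\<^sup>2 - 1)\<^sup>2 / 4 * (N * (c2 x + 1) + N * (c3 x + 1)))"
    by (intro int continuous_intros cont) auto
  note add = set_integral_add(1)[OF 1 2]
  note add = this set_integral_add(1)[OF this 3(1)]
  note add = this set_integral_add(1)[OF this(2) 3(2)]
  note add = this set_integral_add(1)[OF this(3) 3(3)]
  note add = this set_integral_add(1)[OF this(4) 4]
  show "set_integrable lborel \<Omega> (energy_density Rey eps lam F M N u \<phi> c1 c2 c3)"
    unfolding energy_density_def[abs_def] by (rule set_integral_diff(1)[OF add(5) 5])
  show "energy \<Omega> Rey eps lam F M N u \<phi> c1 c2 c3
      = (LINT x:\<Omega>|lborel. energy_density Rey eps lam F M N u \<phi> c1 c2 c3 x)"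
    unfolding energy_density_def set_integral_diff(2)[OF add(5) 5] set_integral_add(2)[OF add(4) 4]
      set_integral_add(2)[OF add(3) 3(3)] set_integral_add(2)[OF add(2) 3(2)]
      set_integral_add(2)[OF add(1) 3(1)] set_integral_add(2)[OF 1 2] set_integral_mult_right
      energy_def L2_norm_power2 ..
qed

text \<open>\<open>A\<close> stands for \<open>c2 + 1\<close> or \<open>c3 + 1\<close>. In the
  discrete product rule the convex \<open>M\<close> part pairs the change of phase with the new
  \<open>A'\<close>, the \<open>N\<close> part with the old \<open>A\<close>. The gap between the
  two sides is exactly \<open>(M * A') * (s' - s)\<^sup>2\<close> plus \<open>N * A\<close> times
  the gap in \<open>double_well_lower_bound\<close>.\<close>

lemma coupling_increment:
  fixes M N A A' s s' S :: real
  assumes "0 \<le> N" "0 \<le> A" "1 / 2 \<le> S" "0 \<le> M" "0 \<le> A'"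
  shows "(s'\<^sup>2 * (M * A') - (s'\<^sup>2 - 1)\<^sup>2 / 4 * (N * A')) - (s\<^sup>2 * (M * A) - (s\<^sup>2 - 1)\<^sup>2 / 4 * (N * A))
    \<le> (s' - s) * (2 * s' * (M * A') - (s ^ 3 - s) * (N * A) + S * (s' - s) * (N * A))
      + (A' - A) * (M * s\<^sup>2 - N / 4 * (s'\<^sup>2 - 1)\<^sup>2)"
proof -
  have "(N * A) * ((s\<^sup>2 - 1)\<^sup>2 / 4 + (s ^ 3 - s) * (s' - s) - S * (s' - s)\<^sup>2) \<le> (N * A) * ((s'\<^sup>2 - 1)\<^sup>2 / 4)"
    using assms by (intro mult_left_mono double_well_lower_bound) auto
  moreover have "0 \<le> (M * A') * (s' - s)\<^sup>2" using assms by simp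
  moreover have "(s' - s) * (2 * s' * (M * A') - (s ^ 3 - s) * (N * A) + S * (s' - s) * (N * A))
      + (A' - A) * (M * s\<^sup>2 - N / 4 * (s'\<^sup>2 - 1)\<^sup>2)
    - ((s'\<^sup>2 * (M * A') - (s'\<^sup>2 - 1)\<^sup>2 / 4 * (N * A')) - (s\<^sup>2 * (M * A) - (s\<^sup>2 - 1)\<^sup>2 / 4 * (N * A)))
    = (N * A) * ((s'\<^sup>2 - 1)\<^sup>2 / 4) - (N * A) * ((s\<^sup>2 - 1)\<^sup>2 / 4 + (s ^ 3 - s) * (s' - s) - S * (s' - s)\<^sup>2)
      + (M * A') * (s' - s)\<^sup>2"
    by (simp add: field_simps power2_eq_square)
  ultimately show ?thesis by linarith
qed

text \<open>The gap is half the squared norm of \<open>a - b\<close>. This serves both the kinetic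
  and the gradient energy.\<close>

lemma inner_diff_self_ge:
  "((norm a)\<^sup>2 - (norm b)\<^sup>2) / 2 \<le> a \<bullet> (a - b)"
  using zero_le_power2[of "norm (a - b)"]
  by (simp add: power2_norm_eq_inner inner_diff_left inner_diff_right inner_commute)

context scheme_step
begin

text \<open>Viscous, pressure and convective parts. The last one carries \<open>|u'|^2\<close> along
  the old velocity, matching the linearized convection of the scheme.\<close>

definition "momentum_flux y = (\<Sum>b\<in>Basis. (u' y \<bullet> b) *\<^sub>R grad (\<lambda>z. u' z \<bullet> b) y) - p y *\<^sub>R u' y
  - (Rey / 2) *\<^sub>R ((u' y \<bullet> u' y) *\<^sub>R u y)"

lemma Ck_closure_momentum_flux: "Ck_closure 1 \<Omega> momentum_flux"
  unfolding momentum_flux_def[abs_def]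
  by (intro Ck_closure_1_intros regular_1 Ck_closure_1_grad Ck_closure_2_inner_const regular)

lemma momentum_test:
  assumes x: "x \<in> \<Omega>"
  shows "Rey * (u' x \<bullet> (u' x - u x))
    = dt * (divergence momentum_flux x - (\<Sum>b\<in>Basis. (norm (grad (\<lambda>z. u' z \<bullet> b) x))\<^sup>2)
        - \<phi> x * (grad \<mu>\<phi> x \<bullet> u' x) - c1' x * (grad \<mu>1 x \<bullet> u' x)
        - c2' x * (grad \<mu>2 x \<bullet> u' x) - c3' x * (grad \<mu>3 x \<bullet> u' x))"
proof -
  let ?B1 = "\<lambda>y. \<Sum>b\<in>Basis. (u' y \<bullet> b) *\<^sub>R grad (\<lambda>z. u' z \<bullet> b) y"
  let ?B2 = "\<lambda>y. p y *\<^sub>R u' y" and ?B3 = "\<lambda>y. (u' y \<bullet> u' y) *\<^sub>R u y"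
  have C: "Ck_closure 1 \<Omega> ?B1" "Ck_closure 1 \<Omega> ?B2" "Ck_closure 1 \<Omega> ?B3"
    "Ck_closure 1 \<Omega> (\<lambda>y. (Rey / 2) *\<^sub>R ?B3 y)" "Ck_closure 1 \<Omega> (\<lambda>y. ?B1 y - ?B2 y)"
    "Ck_closure 1 \<Omega> (\<lambda>y. u' y \<bullet> u' y)"
    by (intro Ck_closure_1_intros regular_1 Ck_closure_1_grad Ck_closure_2_inner_const regular)+
  note d = C[THEN Ck_closure_1_differentiable, OF x] regular_1[THEN Ck_closure_1_differentiable, OF x]
  have "divergence momentum_flux x = divergence ?B1 x - divergence ?B2 x - Rey / 2 * divergence ?B3 x"
    unfolding momentum_flux_def[abs_def] divergence_diff[OF d(5,4)] divergence_diff[OF d(1,2)]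
      divergence_const_scaleR[OF d(3)] ..
  also have "divergence ?B2 x = grad p x \<bullet> u' x"
    by (subst divergence_scaleR) (simp_all add: d incompressible x)
  \<comment> \<open>As \<open>u\<close> is solenoidal, only the derivative of
    \<open>u' \<bullet> u'\<close> along \<open>u\<close> survives. It is twice the tested
    convective term, hence the factor \<open>Rey / 2\<close> in the flux.\<close>
  also have "divergence ?B3 x = 2 * (advect u u' x \<bullet> u' x)"
    by (subst divergence_scaleR) (simp_all add: d incompressible x grad_inner_self advect_def)
  finally have div: "divergence momentum_flux x - (\<Sum>b\<in>Basis. (norm (grad (\<lambda>z. u' z \<bullet> b) x))\<^sup>2)
      = vec_laplacian u' x \<bullet> u' x - grad p x \<bullet> u' x - Rey * (advect u u' x \<bullet> u' x)"
    using vec_laplacian_inner[OF regular(2) x] by simp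
  have "Rey * ((u' x - u x) \<bullet> u' x / dt + advect u u' x \<bullet> u' x)
    = vec_laplacian u' x \<bullet> u' x - grad p x \<bullet> u' x - \<phi> x * (grad \<mu>\<phi> x \<bullet> u' x)
      - (c1' x * (grad \<mu>1 x \<bullet> u' x) + c2' x * (grad \<mu>2 x \<bullet> u' x) + c3' x * (grad \<mu>3 x \<bullet> u' x))"
    using arg_cong[OF momentum[OF x], of "\<lambda>v. v \<bullet> u' x"]
    by (simp add: inner_add_left inner_diff_left divide_inverse mult.commute)
  then have "Rey * ((u' x - u x) \<bullet> u' x / dt)
    = divergence momentum_flux x - (\<Sum>b\<in>Basis. (norm (grad (\<lambda>z. u' z \<bullet> b) x))\<^sup>2)
      - \<phi> x * (grad \<mu>\<phi> x \<bullet> u' x) - c1' x * (grad \<mu>1 x \<bullet> u' x)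
      - c2' x * (grad \<mu>2 x \<bullet> u' x) - c3' x * (grad \<mu>3 x \<bullet> u' x)"
    unfolding div by (simp add: algebra_simps)
  then have "dt * (Rey * ((u' x - u x) \<bullet> u' x / dt)) = dt * (divergence momentum_flux x
      - (\<Sum>b\<in>Basis. (norm (grad (\<lambda>z. u' z \<bullet> b) x))\<^sup>2)
      - \<phi> x * (grad \<mu>\<phi> x \<bullet> u' x) - c1' x * (grad \<mu>1 x \<bullet> u' x)
      - c2' x * (grad \<mu>2 x \<bullet> u' x) - c3' x * (grad \<mu>3 x \<bullet> u' x))"
    by (rule arg_cong)
  then show ?thesis using constants by (simp add: inner_commute)
qed

definition "dissipation x =
   Mob * (norm (grad \<mu>\<phi> x))\<^sup>2
   + (D1 x * (c1' x + 1) / Pe * (norm (grad \<mu>1 x))\<^sup>2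
      + D2 * (c2' x + 1) / Pe * (norm (grad \<mu>2 x))\<^sup>2
      + D3 * (c3' x + 1) / Pe * (norm (grad \<mu>3 x))\<^sup>2)
   + reac k (\<phi> x) * (affinity x)\<^sup>2"

text \<open>The field produced when the gradient term of the phase potential is integrated by parts
  against the phase increment. It enters \<open>energy_flux\<close> without the factor
  \<open>dt\<close>, since the increment is not divided by \<open>dt\<close>.\<close>

definition "Qlam y = (\<phi>' y - \<phi> y) *\<^sub>R (lam (c3 y) *\<^sub>R grad \<phi>' y)"

definition "energy_flux y =
  dt *\<^sub>R (momentum_flux y + \<mu>\<phi> y *\<^sub>R Qphi y + \<mu>1 y *\<^sub>R Q1 y + \<mu>2 y *\<^sub>R Q2 y + \<mu>3 y *\<^sub>R Q3 y)
  + eps\<^sup>2 *\<^sub>R Qlam y"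

lemma Ck_closure_Qlam: "Ck_closure 1 \<Omega> Qlam"
  unfolding Qlam_def[abs_def]
  by (intro Ck_closure_1_intros Ck_closure_1_grad Ck_closure_1_compose[OF lam(1)] regular regular_1)

lemma Ck_closure_energy_flux: "Ck_closure 1 \<Omega> energy_flux"
  unfolding energy_flux_def[abs_def]
  by (intro Ck_closure_1_intros Ck_closure_momentum_flux Ck_closure_Qlam Ck_closure_Q regular_1)

lemma energy_flux_tangential:
  assumes "x \<in> frontier \<Omega>"
  shows "energy_flux x \<bullet> \<nu> x = 0"
  by (simp add: energy_flux_def momentum_flux_def Qlam_def inner_add_left Q_tangential[OF assms]
      boundary[OF assms])

text \<open>Still an identity: in the sum of the tested equations, the advective work terms cancel
  against the forces in \<open>momentum_test\<close>. Inequalities enter only when the increments on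
  the right are compared with the energy.\<close>

lemma divergence_energy_flux:
  assumes x: "x \<in> \<Omega>"
  shows "divergence energy_flux x - dt * dissipation x
    = Rey * (u' x \<bullet> (u' x - u x)) + dt * (\<Sum>b\<in>Basis. (norm (grad (\<lambda>z. u' z \<bullet> b) x))\<^sup>2)
      + \<mu>\<phi> x * (\<phi>' x - \<phi> x) + \<mu>1 x * (c1' x - c1 x) + \<mu>2 x * (c2' x - c2 x) + \<mu>3 x * (c3' x - c3 x)
      + eps\<^sup>2 * divergence Qlam x"
proof -
  have C: "Ck_closure 1 \<Omega> (\<lambda>y. \<mu>\<phi> y *\<^sub>R Qphi y)" "Ck_closure 1 \<Omega> (\<lambda>y. \<mu>1 y *\<^sub>R Q1 y)"
    "Ck_closure 1 \<Omega> (\<lambda>y. \<mu>2 y *\<^sub>R Q2 y)" "Ck_closure 1 \<Omega> (\<lambda>y. \<mu>3 y *\<^sub>R Q3 y)"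
    by (intro Ck_closure_1_intros Ck_closure_Q regular_1)+
  note C' = Ck_closure_momentum_flux C
  note C'' = Ck_closure_1_add[OF C'(1,2)]
  note C'' = this Ck_closure_1_add[OF this C'(3)]
  note C'' = this Ck_closure_1_add[OF this(2) C'(4)]
  note C'' = this Ck_closure_1_add[OF this(3) C'(5)]
  note d = C'[THEN Ck_closure_1_differentiable, OF x] and e = C''[THEN Ck_closure_1_differentiable, OF x]
    and f = Ck_closure_1_differentiable[OF Ck_closure_1_scaleR[OF Ck_closure_1_const C''(4)] x]
      Ck_closure_1_differentiable[OF Ck_closure_1_scaleR[OF Ck_closure_1_const Ck_closure_Qlam] x]
      Ck_closure_1_differentiable[OF Ck_closure_Qlam x]
  have div: "divergence energy_flux x = dt * (divergence momentum_flux x + divergence (\<lambda>y. \<mu>\<phi> y *\<^sub>R Qphi y) x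
      + divergence (\<lambda>y. \<mu>1 y *\<^sub>R Q1 y) x + divergence (\<lambda>y. \<mu>2 y *\<^sub>R Q2 y) x
      + divergence (\<lambda>y. \<mu>3 y *\<^sub>R Q3 y) x) + eps\<^sup>2 * divergence Qlam x"
    unfolding energy_flux_def[abs_def] divergence_add[OF f(1,2)] divergence_const_scaleR[OF f(3)]
      divergence_const_scaleR[OF e(4)] divergence_add[OF e(3) d(5)] divergence_add[OF e(2) d(4)]
      divergence_add[OF e(1) d(3)] divergence_add[OF d(1,2)] ..
  have t: "\<mu>\<phi> x * divergence Qphi x = divergence (\<lambda>y. \<mu>\<phi> y *\<^sub>R Qphi y) x
      - 1 * Mob * (norm (grad \<mu>\<phi> x))\<^sup>2 + \<phi> x * (grad \<mu>\<phi> x \<bullet> u' x)"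
    "\<mu>1 x * divergence Q1 x = divergence (\<lambda>y. \<mu>1 y *\<^sub>R Q1 y) x
      - 1 / Pe * (D1 x * (c1' x + 1)) * (norm (grad \<mu>1 x))\<^sup>2 + c1' x * (grad \<mu>1 x \<bullet> u' x)"
    "\<mu>2 x * divergence Q2 x = divergence (\<lambda>y. \<mu>2 y *\<^sub>R Q2 y) x
      - D2 / Pe * (c2' x + 1) * (norm (grad \<mu>2 x))\<^sup>2 + c2' x * (grad \<mu>2 x \<bullet> u' x)"
    "\<mu>3 x * divergence Q3 x = divergence (\<lambda>y. \<mu>3 y *\<^sub>R Q3 y) x
      - D3 / Pe * (c3' x + 1) * (norm (grad \<mu>3 x))\<^sup>2 + c3' x * (grad \<mu>3 x \<bullet> u' x)"
    unfolding Qphi_def Q1_def Q2_def Q3_def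
    by (intro divergence_scaleR_flux[OF _ _ _ _ x] Ck_closure_1_intros regular regular_1)+
  \<comment> \<open>The potentials weight the reaction terms by \<open>a1\<close>, \<open>a2\<close>
    and \<open>- a3\<close>, which assembles a second factor \<open>affinity x\<close> and gives the
    reaction dissipation its sign.\<close>
  have "\<mu>\<phi> x * (\<phi>' x - \<phi> x) + \<mu>1 x * (c1' x - c1 x) + \<mu>2 x * (c2' x - c2 x) + \<mu>3 x * (c3' x - c3 x)
    = dt * (\<mu>\<phi> x * divergence Qphi x + \<mu>1 x * divergence Q1 x + \<mu>2 x * divergence Q2 x
      + \<mu>3 x * divergence Q3 x - reac k (\<phi> x) * (affinity x)\<^sup>2)"
    unfolding balance[OF x] by (simp add: affinity_def power2_eq_square algebra_simps)
  then show ?thesis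
    unfolding div momentum_test[OF x] t dissipation_def by (simp add: algebra_simps add_divide_distrib)
qed

lemma energy_density_step:
  assumes x: "x \<in> \<Omega>" and FS: "\<And>s. deriv (deriv F) s \<le> 2 * S" and S: "1 / 2 \<le> S"
  shows "energy_density Rey eps lam F M N u' \<phi>' c1' c2' c3' x - energy_density Rey eps lam F M N u \<phi> c1 c2 c3 x
    \<le> divergence energy_flux x - dt * dissipation x"
proof -
  let ?l = "lam (c3 x)" and ?\<psi> = "\<phi>' x - \<phi> x"
  let ?G' = "(norm (grad \<phi>' x))\<^sup>2" and ?G = "(norm (grad \<phi> x))\<^sup>2"
  have kin: "Rey / 2 * (norm (u' x))\<^sup>2 - Rey / 2 * (norm (u x))\<^sup>2 \<le> Rey * (u' x \<bullet> (u' x - u x))"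
    using mult_left_mono[OF inner_diff_self_ge[of "u' x" "u x"], of Rey] constants
    by (simp add: field_simps)
  have "Ck_closure 1 \<Omega> (\<lambda>y. \<phi>' y - \<phi> y)" "Ck_closure 1 \<Omega> (\<lambda>y. lam (c3 y) *\<^sub>R grad \<phi>' y)"
    by (intro Ck_closure_1_intros Ck_closure_1_grad Ck_closure_1_compose[OF lam(1)] regular regular_1)+
  note d = this[THEN Ck_closure_1_differentiable, OF x]
  have "divergence Qlam x = ?\<psi> * divergence (\<lambda>y. lam (c3 y) *\<^sub>R grad \<phi>' y) x
      + ?l * (grad \<phi>' x \<bullet> (grad \<phi>' x - grad \<phi> x))"
    unfolding Qlam_def[abs_def] divergence_scaleR[OF d]
    using regular(3,4)[THEN Ck_closure_2_imp_1, THEN Ck_closure_1_differentiable, OF x]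
    by (simp add: grad_diff inner_commute)
  moreover have "?l * ((?G' - ?G) / 2) \<le> ?l * (grad \<phi>' x \<bullet> (grad \<phi>' x - grad \<phi> x))"
    using lam(2)[of "c3 x"] by (intro mult_left_mono inner_diff_self_ge) simp
  ultimately have "eps\<^sup>2 * (?l * ((?G' - ?G) / 2))
      \<le> eps\<^sup>2 * (divergence Qlam x - ?\<psi> * divergence (\<lambda>y. lam (c3 y) *\<^sub>R grad \<phi>' y) x)"
    by (intro mult_left_mono) auto
  then have gradient: "eps\<^sup>2 * ?l * ((?G' - ?G) / 2)
      \<le> eps\<^sup>2 * divergence Qlam x - ?\<psi> * (eps\<^sup>2 * divergence (\<lambda>y. lam (c3 y) *\<^sub>R grad \<phi>' y) x)"
    by (simp add: algebra_simps)
  have "F (\<phi>' x) \<le> F (\<phi> x) + deriv F (\<phi> x) * ?\<psi> + S * ?\<psi>\<^sup>2"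
    using quadratic_upper_bound[OF Ck_on_1_real(1)[OF Ck_on_2D(2)[OF F]]
        Ck_on_1_real(1)[OF Ck_on_2_deriv[OF F]] FS] .
  then have "?l * (F (\<phi>' x) - F (\<phi> x)) \<le> ?l * (deriv F (\<phi> x) * ?\<psi> + S * ?\<psi>\<^sup>2)"
    using lam(2)[of "c3 x"] by (intro mult_left_mono) auto
  then have potential: "?l * (F (\<phi>' x) - F (\<phi> x)) \<le> ?\<psi> * (?l * deriv F (\<phi> x) + ?l * S * ?\<psi>)"
    by (simp add: algebra_simps power2_eq_square)
  note pos = positive[OF x]
  have entropy: "(c1' x + 1) * (ln (c1' x + 1) - 1) - (c1 x + 1) * (ln (c1 x + 1) - 1) \<le> (c1' x - c1 x) * ln (c1' x + 1)"
    "(c2' x + 1) * (ln (c2' x + 1) - 1) - (c2 x + 1) * (ln (c2 x + 1) - 1) \<le> (c2' x - c2 x) * ln (c2' x + 1)"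
    "(c3' x + 1) * (ln (c3' x + 1) - 1) - (c3 x + 1) * (ln (c3 x + 1) - 1) \<le> (c3' x - c3 x) * ln (c3' x + 1)"
    using entropy_convex[OF pos(1,2)] entropy_convex[OF pos(3,4)] entropy_convex[OF pos(5,6)] by simp_all
  note coupling = coupling_increment[OF constants(5) less_imp_le[OF pos(3)] S constants(4) less_imp_le[OF pos(4)], of "\<phi>' x" "\<phi> x"]
    coupling_increment[OF constants(5) less_imp_le[OF pos(5)] S constants(4) less_imp_le[OF pos(6)], of "\<phi>' x" "\<phi> x"]
  \<comment> \<open>The change of \<open>lam\<close> is met exactly, with the phase energy at the
    new level. The complementary change, with \<open>lam\<close> frozen at the old concentration, is
    the content of \<open>gradient\<close> and \<open>potential\<close>.\<close>
  have quot: "(c3' x - c3 x) * \<mu>3 x = (lam (c3' x) - ?l) * (F (\<phi>' x) + eps\<^sup>2 / 2 * ?G')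
      + (c3' x - c3 x) * ln (c3' x + 1) + (c3' x - c3 x) * (M * (\<phi> x)\<^sup>2 - N / 4 * ((\<phi>' x)\<^sup>2 - 1)\<^sup>2)"
  proof -
    have "t * (q * Z + l + a - b) = t * q * Z + t * l + t * (a - b)" for t q Z l a b :: real
      by (simp add: algebra_simps)
    then show ?thesis unfolding potential3[OF x] diff_quot_mult[symmetric] .
  qed
  \<comment> \<open>Absent from \<open>dissipation\<close>, so only its sign is used and it is given
    away to T.\<close>
  have dissip: "0 \<le> dt * (\<Sum>b\<in>Basis. (norm (grad (\<lambda>z. u' z \<bullet> b) x))\<^sup>2)"
    using constants by (intro mult_nonneg_nonneg sum_nonneg) auto
  \<comment> \<open>Inserting the potentials and grouping so that each summand faces one of the
    energy increments estimated above; \<open>\<mu>3 x\<close> stays unexpanded because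
    \<open>quot\<close> treats it as a whole.\<close>
  have rhs: "divergence energy_flux x - dt * dissipation x
    = Rey * (u' x \<bullet> (u' x - u x)) + dt * (\<Sum>b\<in>Basis. (norm (grad (\<lambda>z. u' z \<bullet> b) x))\<^sup>2)
      + (eps\<^sup>2 * divergence Qlam x - ?\<psi> * (eps\<^sup>2 * divergence (\<lambda>y. lam (c3 y) *\<^sub>R grad \<phi>' y) x))
      + ?\<psi> * (?l * deriv F (\<phi> x) + ?l * S * ?\<psi>)
      + ?\<psi> * (2 * \<phi>' x * (M * (c2' x + 1)) - (\<phi> x ^ 3 - \<phi> x) * (N * (c2 x + 1)) + S * ?\<psi> * (N * (c2 x + 1)))
      + ?\<psi> * (2 * \<phi>' x * (M * (c3' x + 1)) - (\<phi> x ^ 3 - \<phi> x) * (N * (c3 x + 1)) + S * ?\<psi> * (N * (c3 x + 1)))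
      + (c1' x - c1 x) * ln (c1' x + 1)
      + (c2' x - c2 x) * ln (c2' x + 1) + (c2' x - c2 x) * (M * (\<phi> x)\<^sup>2 - N / 4 * ((\<phi>' x)\<^sup>2 - 1)\<^sup>2)
      + (c3' x - c3 x) * \<mu>3 x"
    unfolding divergence_energy_flux[OF x] phase_potential[OF x] potential1[OF x] potential2[OF x]
    by (simp add: algebra_simps)
  let ?U = "\<lambda>s A. s\<^sup>2 * (M * A) - (s\<^sup>2 - 1)\<^sup>2 / 4 * (N * A)"
  have "energy_density Rey eps lam F M N u' \<phi>' c1' c2' c3' x - energy_density Rey eps lam F M N u \<phi> c1 c2 c3 x
    = (Rey / 2 * (norm (u' x))\<^sup>2 - Rey / 2 * (norm (u x))\<^sup>2)
      + eps\<^sup>2 * ?l * ((?G' - ?G) / 2) + ?l * (F (\<phi>' x) - F (\<phi> x))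
      + (lam (c3' x) - ?l) * (F (\<phi>' x) + eps\<^sup>2 / 2 * ?G')
      + ((c1' x + 1) * (ln (c1' x + 1) - 1) - (c1 x + 1) * (ln (c1 x + 1) - 1))
      + ((c2' x + 1) * (ln (c2' x + 1) - 1) - (c2 x + 1) * (ln (c2 x + 1) - 1))
      + ((c3' x + 1) * (ln (c3' x + 1) - 1) - (c3 x + 1) * (ln (c3 x + 1) - 1))
      + (?U (\<phi>' x) (c2' x + 1) - ?U (\<phi> x) (c2 x + 1)) + (?U (\<phi>' x) (c3' x + 1) - ?U (\<phi> x) (c3 x + 1))"
    unfolding energy_density_def by (simp add: algebra_simps add_divide_distrib diff_divide_distrib)
  then show ?thesis
    using kin gradient potential entropy coupling[unfolded add_diff_cancel_right] quot dissip
    unfolding rhs by linarith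
qed

end

context scheme_step
begin

lemma integral_dissipation:
  shows "set_integrable lborel \<Omega> dissipation"
    and "(LINT x:\<Omega>|lborel. dissipation x) = Mob * (L2_norm \<Omega> (grad \<mu>\<phi>))\<^sup>2
      + (LINT x:\<Omega>|lborel. D1 x * (c1' x + 1) / Pe * (norm (grad \<mu>1 x))\<^sup>2
          + D2 * (c2' x + 1) / Pe * (norm (grad \<mu>2 x))\<^sup>2
          + D3 * (c3' x + 1) / Pe * (norm (grad \<mu>3 x))\<^sup>2)
      + (L2_norm \<Omega> (\<lambda>x. sqrt (reac k (\<phi> x)) * (a1 * \<mu>1 x + a2 * \<mu>2 x - a3 * \<mu>3 x)))\<^sup>2"
    and "0 \<le> (LINT x:\<Omega>|lborel. dissipation x)"
proof -
  have reac0: "0 \<le> reac k s" for s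
    using constants by (simp add: reac_def)
  note cont = regular_1[THEN Ck_closure_1_continuous_on] regular(12-15)[THEN Ck_closure_2_imp_1, THEN Ck_closure_1_continuous_on_grad]
    continuous_on_compose2[OF continuous_on_reac[of UNIV]]
  note int = set_integrable_continuous_on_closure[OF domain(1,2)]
  have 1: "set_integrable lborel \<Omega> (\<lambda>x. Mob * (norm (grad \<mu>\<phi> x))\<^sup>2)"
    by (intro int continuous_intros cont)
  have 2: "set_integrable lborel \<Omega> (\<lambda>x. D1 x * (c1' x + 1) / Pe * (norm (grad \<mu>1 x))\<^sup>2
      + D2 * (c2' x + 1) / Pe * (norm (grad \<mu>2 x))\<^sup>2 + D3 * (c3' x + 1) / Pe * (norm (grad \<mu>3 x))\<^sup>2)"
    using constants by (intro int continuous_intros cont) auto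
  have 3: "set_integrable lborel \<Omega> (\<lambda>x. reac k (\<phi> x) * (affinity x)\<^sup>2)"
    unfolding affinity_def by (intro int continuous_intros cont) auto
  note add = set_integral_add[OF 1 2]
  show "set_integrable lborel \<Omega> dissipation"
    unfolding dissipation_def[abs_def] by (rule set_integral_add(1)[OF add(1) 3])
  have "(norm (sqrt (reac k (\<phi> x)) * (a1 * \<mu>1 x + a2 * \<mu>2 x - a3 * \<mu>3 x)))\<^sup>2
      = reac k (\<phi> x) * (affinity x)\<^sup>2" for x
    by (simp add: affinity_def power_mult_distrib reac0)
  then show "(LINT x:\<Omega>|lborel. dissipation x) = Mob * (L2_norm \<Omega> (grad \<mu>\<phi>))\<^sup>2
      + (LINT x:\<Omega>|lborel. D1 x * (c1' x + 1) / Pe * (norm (grad \<mu>1 x))\<^sup>2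
          + D2 * (c2' x + 1) / Pe * (norm (grad \<mu>2 x))\<^sup>2
          + D3 * (c3' x + 1) / Pe * (norm (grad \<mu>3 x))\<^sup>2)
      + (L2_norm \<Omega> (\<lambda>x. sqrt (reac k (\<phi> x)) * (a1 * \<mu>1 x + a2 * \<mu>2 x - a3 * \<mu>3 x)))\<^sup>2"
    unfolding dissipation_def set_integral_add(2)[OF add(1) 3] add(2) L2_norm_power2 set_integral_mult_right
    by simp
  have "0 \<le> dissipation x" if "x \<in> \<Omega>" for x
    unfolding dissipation_def using constants positive[OF that] reac0[of "\<phi> x"]
    by (intro add_nonneg_nonneg) simp_all
  then show "0 \<le> (LINT x:\<Omega>|lborel. dissipation x)"
    unfolding set_lebesgue_integral_def by (intro integral_nonneg_AE AE_I2) (auto simp: indicator_def)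
qed

lemma energy_stability:
  assumes "\<And>s. deriv (deriv F) s \<le> 2 * S" "1 / 2 \<le> S"
  shows "energy \<Omega> Rey eps lam F M N u' \<phi>' c1' c2' c3' - energy \<Omega> Rey eps lam F M N u \<phi> c1 c2 c3
    \<le> - dt * (LINT x:\<Omega>|lborel. dissipation x)"
proof -
  let ?e = "energy_density Rey eps lam F M N u \<phi> c1 c2 c3"
    and ?e' = "energy_density Rey eps lam F M N u' \<phi>' c1' c2' c3'"
  have E: "set_integrable lborel \<Omega> ?e" "energy \<Omega> Rey eps lam F M N u \<phi> c1 c2 c3 = (LINT x:\<Omega>|lborel. ?e x)"
    by (intro energy_eq_integral domain lam F regular positive; assumption)+
  have E': "set_integrable lborel \<Omega> ?e'" "energy \<Omega> Rey eps lam F M N u' \<phi>' c1' c2' c3' = (LINT x:\<Omega>|lborel. ?e' x)"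
    by (intro energy_eq_integral domain lam F regular positive; assumption)+
  have div: "set_integrable lborel \<Omega> (divergence energy_flux)" "(LINT x:\<Omega>|lborel. divergence energy_flux x) = 0"
    by (intro integral_divergence_eq_0[OF Ck_closure_energy_flux] energy_flux_tangential; assumption)+
  have dis: "set_integrable lborel \<Omega> (\<lambda>x. dt * dissipation x)"
    by (intro set_integrable_mult_right integral_dissipation(1))
  have "(LINT x:\<Omega>|lborel. ?e' x - ?e x) \<le> (LINT x:\<Omega>|lborel. divergence energy_flux x - dt * dissipation x)"
    by (intro set_integral_mono set_integral_diff(1) E(1) E'(1) div(1) dis energy_density_step assms)
  also have "\<dots> = - dt * (LINT x:\<Omega>|lborel. dissipation x)"
    unfolding set_integral_diff(2)[OF div(1) dis] div(2) set_integral_mult_right by simp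
  finally show ?thesis
    unfolding E(2) E'(2) set_integral_diff(2)[OF E'(1) E(1)] .
qed

end

section \<open>The scheme over all time steps\<close>

theorem theorem3p1:
  fixes \<Omega> :: "(real ^ 'd::finite) set"
    and \<nu> :: "real ^ 'd \<Rightarrow> real ^ 'd"
    and Rey Pe eps Mob M N D2 D3 D1p D1m k S a1 a2 a3 M0 L dt :: real
    and lam F :: "real \<Rightarrow> real"
    and u :: "nat \<Rightarrow> real ^ 'd \<Rightarrow> real ^ 'd"
    and p \<phi> \<mu>\<phi> c1 \<mu>1 c2 \<mu>2 c3 \<mu>3 q D1 :: "nat \<Rightarrow> real ^ 'd \<Rightarrow> real"
  assumes dim: "CARD('d) = 2 \<or> CARD('d) = 3"
    and domain: "bounded_domain \<Omega>" "C1_boundary_normal \<Omega> \<nu>"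
    and constants: "Rey > 0" "Pe > 0" "eps > 0" "Mob \<ge> 0" "M \<ge> 0" "N \<ge> 0"
      "D2 > 0" "D3 > 0" "D1p > 0" "D1m > 0" "k \<ge> 0" "S \<ge> 0" "a1 + a2 = a3" "dt > 0"
    and lam: "Ck_on 1 UNIV lam" "\<And>s. lam s > 0"
    and potential: "Ck_on 2 UNIV F" "M0 \<ge> 1"
      "\<And>s. \<bar>s\<bar> \<le> M0 \<Longrightarrow> F s = 1 / 4 * (s\<^sup>2 - 1)\<^sup>2"
      "\<And>s. \<bar>deriv (deriv F) s\<bar> \<le> L"
    and regular_state: "\<And>n. Ck_closure 2 \<Omega> (u n)" "\<And>n. Ck_closure 2 \<Omega> (\<phi> n)"
      "\<And>n. Ck_closure 1 \<Omega> (c1 n)" "\<And>n. Ck_closure 1 \<Omega> (c2 n)" "\<And>n. Ck_closure 1 \<Omega> (c3 n)"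
    and regular_step: "\<And>n. Ck_closure 1 \<Omega> (p (Suc n))" "\<And>n. Ck_closure 2 \<Omega> (\<mu>\<phi> (Suc n))"
      "\<And>n. Ck_closure 2 \<Omega> (\<mu>1 (Suc n))" "\<And>n. Ck_closure 2 \<Omega> (\<mu>2 (Suc n))"
      "\<And>n. Ck_closure 2 \<Omega> (\<mu>3 (Suc n))" "\<And>n. Ck_closure 1 \<Omega> (D1 n)"
    and positive: "\<And>n x. x \<in> \<Omega> \<Longrightarrow> c1 n x + 1 > 0" "\<And>n x. x \<in> \<Omega> \<Longrightarrow> c2 n x + 1 > 0"
      "\<And>n x. x \<in> \<Omega> \<Longrightarrow> c3 n x + 1 > 0" "\<And>n x. x \<in> \<Omega> \<Longrightarrow> q n x > 0"
      "\<And>n x. x \<in> \<Omega> \<Longrightarrow> D1 n x > 0"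
    and initial: "\<And>x. x \<in> \<Omega> \<Longrightarrow> divergence (u 0) x = 0" "\<And>x. x \<in> frontier \<Omega> \<Longrightarrow> u 0 x = 0"
    and momentum: "\<And>n x. x \<in> \<Omega> \<Longrightarrow>
      Rey *\<^sub>R ((u (Suc n) x - u n x) /\<^sub>R dt + advect (u n) (u (Suc n)) x)
      = vec_laplacian (u (Suc n)) x - grad (p (Suc n)) x - \<phi> n x *\<^sub>R grad (\<mu>\<phi> (Suc n)) x
        - (c1 (Suc n) x *\<^sub>R grad (\<mu>1 (Suc n)) x + c2 (Suc n) x *\<^sub>R grad (\<mu>2 (Suc n)) x
           + c3 (Suc n) x *\<^sub>R grad (\<mu>3 (Suc n)) x)"
    and incompressible: "\<And>n x. x \<in> \<Omega> \<Longrightarrow> divergence (u (Suc n)) x = 0"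
    and phase: "\<And>n x. x \<in> \<Omega> \<Longrightarrow>
      (\<phi> (Suc n) x - \<phi> n x) / dt + divergence (\<lambda>y. \<phi> n y *\<^sub>R u (Suc n) y) x
      = divergence (\<lambda>y. Mob *\<^sub>R grad (\<mu>\<phi> (Suc n)) y) x"
    and phase_potential: "\<And>n x. x \<in> \<Omega> \<Longrightarrow>
      \<mu>\<phi> (Suc n) x =
        - eps\<^sup>2 * divergence (\<lambda>y. lam (c3 n y) *\<^sub>R grad (\<phi> (Suc n)) y) x
        + lam (c3 n x) * deriv F (\<phi> n x) + lam (c3 n x) * S * (\<phi> (Suc n) x - \<phi> n x)
        + 2 * \<phi> (Suc n) x * (M * (c2 (Suc n) x + 1) + M * (c3 (Suc n) x + 1))
        - ((\<phi> n x) ^ 3 - \<phi> n x) * (N * (c2 n x + 1) + N * (c3 n x + 1))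
        + S * (\<phi> (Suc n) x - \<phi> n x) * (N * (c2 n x + 1) + N * (c3 n x + 1))"
    and species1: "\<And>n x. x \<in> \<Omega> \<Longrightarrow>
      (c1 (Suc n) x - c1 n x) / dt + divergence (\<lambda>y. c1 (Suc n) y *\<^sub>R u (Suc n) y) x
      = 1 / Pe * divergence (\<lambda>y. (D1 n y * (c1 (Suc n) y + 1)) *\<^sub>R grad (\<mu>1 (Suc n)) y) x
        - a1 * reac k (\<phi> n x) * (a1 * \<mu>1 (Suc n) x + a2 * \<mu>2 (Suc n) x - a3 * \<mu>3 (Suc n) x)"
    and potential1: "\<And>n x. x \<in> \<Omega> \<Longrightarrow> \<mu>1 (Suc n) x = ln (c1 (Suc n) x + 1)"
    and diffusivity1: "\<And>n x. x \<in> \<Omega> \<Longrightarrow>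
      1 / D1 n x = ((\<phi> n x)\<^sup>2 - 1)\<^sup>2 / (q n x * eps)
        + (1 - \<phi> n x) / (2 * D1m) + (1 + \<phi> n x) / (2 * D1p)"
    and species2: "\<And>n x. x \<in> \<Omega> \<Longrightarrow>
      (c2 (Suc n) x - c2 n x) / dt + divergence (\<lambda>y. c2 (Suc n) y *\<^sub>R u (Suc n) y) x
      = D2 / Pe * divergence (\<lambda>y. (c2 (Suc n) y + 1) *\<^sub>R grad (\<mu>2 (Suc n)) y) x
        - a2 * reac k (\<phi> n x) * (a1 * \<mu>1 (Suc n) x + a2 * \<mu>2 (Suc n) x - a3 * \<mu>3 (Suc n) x)"
    and potential2: "\<And>n x. x \<in> \<Omega> \<Longrightarrow>
      \<mu>2 (Suc n) x = ln (c2 (Suc n) x + 1) + M * (\<phi> n x)\<^sup>2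
        - N / 4 * ((\<phi> (Suc n) x)\<^sup>2 - 1)\<^sup>2"
    and species3: "\<And>n x. x \<in> \<Omega> \<Longrightarrow>
      (c3 (Suc n) x - c3 n x) / dt + divergence (\<lambda>y. c3 (Suc n) y *\<^sub>R u (Suc n) y) x
      = D3 / Pe * divergence (\<lambda>y. (c3 (Suc n) y + 1) *\<^sub>R grad (\<mu>3 (Suc n)) y) x
        + a3 * reac k (\<phi> n x) * (a1 * \<mu>1 (Suc n) x + a2 * \<mu>2 (Suc n) x - a3 * \<mu>3 (Suc n) x)"
    and potential3: "\<And>n x. x \<in> \<Omega> \<Longrightarrow>
      \<mu>3 (Suc n) x =
        diff_quot lam (c3 n x) (c3 (Suc n) x)
          * (F (\<phi> (Suc n) x) + eps\<^sup>2 / 2 * (norm (grad (\<phi> (Suc n)) x))\<^sup>2)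
        + ln (c3 (Suc n) x + 1) + M * (\<phi> n x)\<^sup>2 - N / 4 * ((\<phi> (Suc n) x)\<^sup>2 - 1)\<^sup>2"
    and boundary: "\<And>n x. x \<in> frontier \<Omega> \<Longrightarrow> u (Suc n) x = 0"
      "\<And>n x. x \<in> frontier \<Omega> \<Longrightarrow> grad (\<phi> (Suc n)) x \<bullet> \<nu> x = 0"
      "\<And>n x. x \<in> frontier \<Omega> \<Longrightarrow> grad (\<mu>\<phi> (Suc n)) x \<bullet> \<nu> x = 0"
      "\<And>n x. x \<in> frontier \<Omega> \<Longrightarrow> grad (c1 (Suc n)) x \<bullet> \<nu> x = 0"
      "\<And>n x. x \<in> frontier \<Omega> \<Longrightarrow> grad (c2 (Suc n)) x \<bullet> \<nu> x = 0"
      "\<And>n x. x \<in> frontier \<Omega> \<Longrightarrow> grad (c3 (Suc n)) x \<bullet> \<nu> x = 0"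
      "\<And>n x. x \<in> frontier \<Omega> \<Longrightarrow> grad (\<mu>1 (Suc n)) x \<bullet> \<nu> x = 0"
      "\<And>n x. x \<in> frontier \<Omega> \<Longrightarrow> grad (\<mu>2 (Suc n)) x \<bullet> \<nu> x = 0"
      "\<And>n x. x \<in> frontier \<Omega> \<Longrightarrow> grad (\<mu>3 (Suc n)) x \<bullet> \<nu> x = 0"
  shows "(\<forall>n. (LINT x:\<Omega>|lborel. c1 n x + c2 n x + c3 n x)
             = (LINT x:\<Omega>|lborel. c1 0 x + c2 0 x + c3 0 x)) \<and>
    (S \<ge> L / 2 \<longrightarrow> (\<forall>n. \<exists>T\<ge>0.
      let E = (\<lambda>m. energy \<Omega> Rey eps lam F M N (u m) (\<phi> m) (c1 m) (c2 m) (c3 m));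
          R = - dt * (Mob * (L2_norm \<Omega> (grad (\<mu>\<phi> (Suc n))))\<^sup>2
            + (LINT x:\<Omega>|lborel.
                 D1 n x * (c1 (Suc n) x + 1) / Pe * (norm (grad (\<mu>1 (Suc n)) x))\<^sup>2
               + D2 * (c2 (Suc n) x + 1) / Pe * (norm (grad (\<mu>2 (Suc n)) x))\<^sup>2
               + D3 * (c3 (Suc n) x + 1) / Pe * (norm (grad (\<mu>3 (Suc n)) x))\<^sup>2)
            + (L2_norm \<Omega> (\<lambda>x. sqrt (reac k (\<phi> n x))
                 * (a1 * \<mu>1 (Suc n) x + a2 * \<mu>2 (Suc n) x - a3 * \<mu>3 (Suc n) x)))\<^sup>2)
      in E (Suc n) - E n + T = R \<and> R \<le> 0))"
proof -
  have \<Omega>: "open \<Omega>" "bounded \<Omega>"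
    using domain(1) by (simp_all add: bounded_domain_def)
  \<comment> \<open>The old velocity of a step is initial data when \<open>n = 0\<close> and the
    outcome of the previous step otherwise.\<close>
  have u: "x \<in> \<Omega> \<Longrightarrow> divergence (u n) x = 0" "x \<in> frontier \<Omega> \<Longrightarrow> u n x = 0" for n x
    using initial incompressible boundary(1) by (cases n; simp)+
  have step: "scheme_step \<Omega> \<nu> Rey Pe eps Mob M N D2 D3 k S a1 a2 a3 dt lam F (u n) (u (Suc n))
      (\<phi> n) (\<phi> (Suc n)) (c1 n) (c1 (Suc n)) (c2 n) (c2 (Suc n)) (c3 n) (c3 (Suc n))
      (p (Suc n)) (\<mu>\<phi> (Suc n)) (\<mu>1 (Suc n)) (\<mu>2 (Suc n)) (\<mu>3 (Suc n)) (D1 n)" for n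
    by (rule scheme_step.intro)
      (fact \<Omega> domain(2) constants lam potential(1) regular_state regular_step positive u momentum phase
        phase_potential species1 potential1 species2 potential2 species3 potential3 boundary)+
  have mass: "(LINT x:\<Omega>|lborel. c1 n x + c2 n x + c3 n x) = (LINT x:\<Omega>|lborel. c1 0 x + c2 0 x + c3 0 x)" for n
    by (induction n) (simp_all add: scheme_step.mass_conservation[OF step])
  have L: "1 \<le> L"
    using potential(4)[of 0] deriv_double_well_0[of F M0, OF potential(1) _ potential(3)] potential(2) by simp
  have FS: "deriv (deriv F) s \<le> 2 * S" if "L / 2 \<le> S" for s
    using potential(4)[of s] that by linarith
  show ?thesis
  proof (intro conjI allI impI mass)
    fix n
    assume S: "S \<ge> L / 2"
    note dis = scheme_step.integral_dissipation[OF step, of n]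
    have le: "energy \<Omega> Rey eps lam F M N (u (Suc n)) (\<phi> (Suc n)) (c1 (Suc n)) (c2 (Suc n)) (c3 (Suc n))
        - energy \<Omega> Rey eps lam F M N (u n) (\<phi> n) (c1 n) (c2 n) (c3 n)
      \<le> - dt * (Mob * (L2_norm \<Omega> (grad (\<mu>\<phi> (Suc n))))\<^sup>2
            + (LINT x:\<Omega>|lborel.
                 D1 n x * (c1 (Suc n) x + 1) / Pe * (norm (grad (\<mu>1 (Suc n)) x))\<^sup>2
               + D2 * (c2 (Suc n) x + 1) / Pe * (norm (grad (\<mu>2 (Suc n)) x))\<^sup>2
               + D3 * (c3 (Suc n) x + 1) / Pe * (norm (grad (\<mu>3 (Suc n)) x))\<^sup>2)
            + (L2_norm \<Omega> (\<lambda>x. sqrt (reac k (\<phi> n x))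
                 * (a1 * \<mu>1 (Suc n) x + a2 * \<mu>2 (Suc n) x - a3 * \<mu>3 (Suc n) x)))\<^sup>2)" (is "?d \<le> ?R")
      using scheme_step.energy_stability[OF step FS[OF S], of n] S L unfolding dis(2) by simp
    have "?R \<le> 0"
      using dis(3) constants unfolding dis(2) by (simp add: mult_nonneg_nonneg)
    then show "\<exists>T\<ge>0.
      let E = (\<lambda>m. energy \<Omega> Rey eps lam F M N (u m) (\<phi> m) (c1 m) (c2 m) (c3 m));
          R = - dt * (Mob * (L2_norm \<Omega> (grad (\<mu>\<phi> (Suc n))))\<^sup>2
            + (LINT x:\<Omega>|lborel.
                 D1 n x * (c1 (Suc n) x + 1) / Pe * (norm (grad (\<mu>1 (Suc n)) x))\<^sup>2
               + D2 * (c2 (Suc n) x + 1) / Pe * (norm (grad (\<mu>2 (Suc n)) x))\<^sup>2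
               + D3 * (c3 (Suc n) x + 1) / Pe * (norm (grad (\<mu>3 (Suc n)) x))\<^sup>2)
            + (L2_norm \<Omega> (\<lambda>x. sqrt (reac k (\<phi> n x))
                 * (a1 * \<mu>1 (Suc n) x + a2 * \<mu>2 (Suc n) x - a3 * \<mu>3 (Suc n) x)))\<^sup>2)
      in E (Suc n) - E n + T = R \<and> R \<le> 0"
      \<comment> \<open>The witness T is the gap \<open>?R - ?d\<close> itself: it holds the
        integrated viscous dissipation and all convexity and stabilization remainders.\<close>
      unfolding Let_def using le by (intro exI[of _ "?R - ?d"]) (simp only: diff_ge_0_iff_ge, simp)
  qed
qed

end
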